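(* Let $B=\mathrm{diag}(b_0,\dots,b_n)$ with all $b_k>0$, and let $\mathcal E=\{x\in\mathbb R^{n+1}:(Bx,x)=1\}$. Then the ellipsoid $\mathcal E$ is a totally geodesic submanifold of $\mathbb R^{n+1}\setminus\{0\}$ with the metric $$ds_1^2=\frac{(B\,dx,dx)}{|Bx|^2}=\frac{b_0dx_0^2+\dots+b_ndx_n^2}{b_0^2x_0^2+\dots+b_n^2x_n^2}.$$ Moreover, the Knörrer parameter $\tau$ is a natural parameter on the corresponding geodesics: if $x(s)$ is a geodesic on $\mathcal E$ for the metric induced from the Euclidean metric, then $x$, reparametrised by $\tau$, is a geodesic of $ds_1^2$ with $\tau$ as its natural (arc length with respect to $ds_1^2$) parameter.
   Context: $(\cdot,\cdot)$ and $|\cdot|$ are the Euclidean inner product and norm. For a geodesic $x(s)$ on $\mathcal E$ (with respect to the metric induced by the Euclidean one, $s$ being Euclidean arc length, ${}'=d/ds$) the Knörrer parameter $\tau$ is defined by $$\frac{d\tau}{ds}=\alpha(s),\qquad \alpha>0,\quad \alpha^2=\frac{(Bx',x')}{|Bx|^2}.$$ *)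

theory Defs
  imports "HOL-Analysis.Analysis"
begin

section \<open>Smooth maps on open subsets of Euclidean spaces\<close>

(* Only used for open S. *)
primrec C_k_on :: "nat \<Rightarrow> 'a::euclidean_space set \<Rightarrow> ('a \<Rightarrow> 'b::real_normed_vector) \<Rightarrow> bool" where
  "C_k_on 0 S f \<longleftrightarrow> continuous_on S f"
| "C_k_on (Suc k) S f \<longleftrightarrow>
     (\<forall>x\<in>S. f differentiable (at x)) \<and> (\<forall>v. C_k_on k S (\<lambda>x. frechet_derivative f (at x) v))"

definition smooth_on :: "'a::euclidean_space set \<Rightarrow> ('a \<Rightarrow> 'b::real_normed_vector) \<Rightarrow> bool" where
  "smooth_on S f \<longleftrightarrow> (\<forall>k. C_k_on k S f)"


section \<open>Embedded submanifolds\<close>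

(* theta is a diffeomorphism of the open set V onto an open set, carrying the slice of V by the
   linear subspace L onto the part of S lying in that open set. Its restriction to V \<inter> L is a local
   parametrisation of S, and L plays the role of the coordinate space R^d with d = dim L. *)
definition slice_chart ::
    "'a::euclidean_space set \<Rightarrow> 'a set \<Rightarrow> 'a set \<Rightarrow> ('a \<Rightarrow> 'a) \<Rightarrow> bool" where
  "slice_chart S L V \<theta> \<longleftrightarrow>
     subspace L \<and> open V \<and> open (\<theta> ` V) \<and> smooth_on V \<theta> \<and>
     (\<exists>\<psi>. smooth_on (\<theta> ` V) \<psi> \<and> (\<forall>y\<in>V. \<psi> (\<theta> y) = y)) \<and>
     \<theta> ` (V \<inter> L) = S \<inter> \<theta> ` V"

definition embedded_submanifold :: "'a::euclidean_space set \<Rightarrow> bool" where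
  "embedded_submanifold S \<longleftrightarrow>
     (\<exists>d. \<forall>p\<in>S. \<exists>L V \<theta>. slice_chart S L V \<theta> \<and> dim L = d \<and> p \<in> \<theta> ` V)"


section \<open>Riemannian metrics and geodesics\<close>

(* g x u v is the inner product at the point x of the tangent vectors u and v. *)
type_synonym 'a metric = "'a \<Rightarrow> 'a \<Rightarrow> 'a \<Rightarrow> real"

definition riemannian_metric_on :: "'a::euclidean_space set \<Rightarrow> 'a metric \<Rightarrow> bool" where
  "riemannian_metric_on M g \<longleftrightarrow>
     open M \<and>
     (\<forall>x\<in>M. bilinear (g x) \<and> (\<forall>u v. g x u v = g x v u) \<and> (\<forall>u. u \<noteq> 0 \<longrightarrow> 0 < g x u u)) \<and>
     (\<forall>u v. smooth_on M (\<lambda>x. g x u v))"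

(* Christoffel symbols of the first kind: with u, v, w the i-th, j-th, k-th coordinate vectors
   this is (d_i g_jk + d_j g_ik - d_k g_ij) / 2. *)
definition christoffel_first ::
    "'a::euclidean_space metric \<Rightarrow> 'a \<Rightarrow> 'a \<Rightarrow> 'a \<Rightarrow> 'a \<Rightarrow> real" where
  "christoffel_first g x u v w =
     (frechet_derivative (\<lambda>y. g y v w) (at x) u
    + frechet_derivative (\<lambda>y. g y u w) (at x) v
    - frechet_derivative (\<lambda>y. g y u v) (at x) w) / 2"

(* The geodesic equation of an open part of the coordinate space L with metric g, in the form
   g_kl c''^l + Gamma_kij c'^i c'^j = 0 obtained by lowering the free index. Only directions in L
   enter: if c stays in L then so do c' and c''. *)
definition geodesic_equation :: "'a::euclidean_space set \<Rightarrow> 'a metric \<Rightarrow> (real \<Rightarrow> 'a) \<Rightarrow> real set \<Rightarrow> bool" where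
  "geodesic_equation L g c I \<longleftrightarrow>
     (\<exists>v a. \<forall>t\<in>I. (c has_vector_derivative v t) (at t) \<and> (v has_vector_derivative a t) (at t) \<and>
        (\<forall>w\<in>L. g (c t) (a t) w + christoffel_first g (c t) (v t) (v t) w = 0))"

definition pullback_metric :: "('a::euclidean_space \<Rightarrow> 'a) \<Rightarrow> 'a metric \<Rightarrow> 'a metric" where
  "pullback_metric \<theta> g y u v =
     g (\<theta> y) (frechet_derivative \<theta> (at y) u) (frechet_derivative \<theta> (at y) v)"

(* The curve c, defined on the open interval I, is a geodesic (with affine parameter) of the
   submanifold S with the metric induced on S by the ambient metric g: in local coordinates of S
   around each of its points it solves the geodesic equation of the induced metric. Since that
   equation is invariant under coordinate changes, one chart around each point is enough. An open
   set S is covered too, with L the whole space, and then g itself is the metric on S. *)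
definition geodesic_on :: "'a::euclidean_space set \<Rightarrow> 'a metric \<Rightarrow> (real \<Rightarrow> 'a) \<Rightarrow> real set \<Rightarrow> bool" where
  "geodesic_on S g c I \<longleftrightarrow>
     open I \<and> is_interval I \<and> c ` I \<subseteq> S \<and>
     (\<forall>t\<^sub>0\<in>I. \<exists>J L V \<theta> \<gamma>.
        open J \<and> t\<^sub>0 \<in> J \<and> J \<subseteq> I \<and> slice_chart S L V \<theta> \<and>
        \<gamma> ` J \<subseteq> V \<inter> L \<and> (\<forall>t\<in>J. c t = \<theta> (\<gamma> t)) \<and>
        geodesic_equation L (pullback_metric \<theta> g) \<gamma> J)"

definition natural_parameter_on :: "'a::euclidean_space metric \<Rightarrow> (real \<Rightarrow> 'a) \<Rightarrow> real set \<Rightarrow> bool" where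
  "natural_parameter_on g c I \<longleftrightarrow>
     (\<forall>t\<in>I. g (c t) (vector_derivative c (at t)) (vector_derivative c (at t)) = 1)"

definition totally_geodesic_submanifold :: "'a::euclidean_space set \<Rightarrow> 'a metric \<Rightarrow> 'a set \<Rightarrow> bool" where
  "totally_geodesic_submanifold M g S \<longleftrightarrow>
     riemannian_metric_on M g \<and> embedded_submanifold S \<and> S \<subseteq> M \<and>
     (\<forall>c I. geodesic_on S g c I \<longrightarrow> geodesic_on M g c I)"

definition euclidean_riemannian_metric :: "'a::euclidean_space metric" where
  "euclidean_riemannian_metric x u v = u \<bullet> v"


section \<open>The ellipsoid, the metric and the Knoerrer parameter\<close>

(* The n + 1 coordinates of the ambient space are indexed by the finite type 'n. *)

definition diag_matrix :: "('n::finite \<Rightarrow> real) \<Rightarrow> real ^ 'n ^ 'n" where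
  "diag_matrix b = (\<chi> i j. if i = j then b i else 0)"

definition ellipsoid :: "real ^ 'n ^ 'n \<Rightarrow> (real ^ 'n) set" where
  "ellipsoid B = {x. (B *v x) \<bullet> x = 1}"

definition ds1_metric :: "real ^ 'n ^ 'n \<Rightarrow> (real ^ 'n) metric" where
  "ds1_metric B x u v = ((B *v u) \<bullet> v) / (norm (B *v x))\<^sup>2"

definition knoerrer_parameter ::
    "real ^ 'n ^ 'n \<Rightarrow> (real \<Rightarrow> real ^ 'n) \<Rightarrow> real set \<Rightarrow> (real \<Rightarrow> real) \<Rightarrow> bool" where
  "knoerrer_parameter B x I \<tau> \<longleftrightarrow>
     (\<exists>\<alpha>. \<forall>s\<in>I. 0 < \<alpha> s \<and>
        (\<alpha> s)\<^sup>2 = ((B *v vector_derivative x (at s)) \<bullet> vector_derivative x (at s))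
                    / (norm (B *v x s))\<^sup>2 \<and>
        (\<tau> has_real_derivative \<alpha> s) (at s))"

end

(*
In local coordinates a curve c in S solves the geodesic equation of the metric induced by g iff
g(c'', w) + Gamma(c', c', w) = 0 for all w tangent to S at c, with Gamma the ambient Christoffel
symbols; this uses the symmetry of the second derivative of the chart. For the ellipsoid and the
metric (B dx, dx) / |Bx|^2 the normal direction at x is x itself, and there the equation follows from
differentiating (Bx, x) = 1 twice. Hence geodesics of the ellipsoid are geodesics of the ambient space.

A Euclidean geodesic on the ellipsoid satisfies x'' = - alpha^2 Bx, and therefore
alpha' / alpha = - 2 (Bx, Bx') / |Bx|^2. With these two identities the curve reparametrised by tau
solves the equation above.
*)
theory Submission
  imports Defs
begin

section \<open>Smooth maps and symmetry of second derivatives\<close>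

text \<open>The charts in \<open>geodesic_on\<close> are only asserted to exist, whereas the
  ellipsoid is handled through its defining equation. Velocities of curves bridge the two:
  \<open>tangent_space\<close> mentions no chart, yet it is the image of \<open>L\<close> under the
  derivative of every slice chart, and for the ellipsoid it is the kernel of w |-> (Bx, w). That x
  is normal can be read off the metric: the product of x and w at x is (Bx, w) / |Bx|^2. The factor
  1 / |Bx|^2 is what makes the equation in the direction x hold: minus half its derivative along x,
  times (Bc', c'), is (Bc', c') / |Bx|^2, which cancels (Bc'', x) / |Bx|^2. Behind this lies a
  symmetry: x |-> x / (Bx, x) is an isometry of the metric whose fixed points form the ellipsoid.
  After reparametrisation by tau the acceleration is -Bx plus a multiple of the velocity. The first
  summand cancels the derivative of the factor along w, the second its derivative along the curve,
  so the equation holds against every w, tangent or not.\<close>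

lemma frechet_derivative_eqI:
  "(f has_derivative f') (at x) \<Longrightarrow> frechet_derivative f (at x) = f'"
  by (metis frechet_derivative_at)

text \<open>A derivative at a point of an open set depends only on nearby values, so equality on
  \<open>S\<close> passes to every order.\<close>

lemma C_k_on_cong:
  assumes "open S" "\<And>x. x \<in> S \<Longrightarrow> f x = g x" "C_k_on k S f"
  shows "C_k_on k S g"
  using assms(2,3)
proof (induction k arbitrary: f g)
  case 0
  then show ?case by (metis C_k_on.simps(1) continuous_on_cong)
next
  case (Suc k)
  have D: "(g has_derivative frechet_derivative f (at x)) (at x)" if "x \<in> S" for x
    using has_derivative_transform_within_open[OF _ assms(1) that, of f _ UNIV g] Suc.prems that
    by (auto simp: frechet_derivative_works)
  have "C_k_on k S (\<lambda>x. frechet_derivative g (at x) v)" for v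
    by (rule Suc.IH[of "\<lambda>x. frechet_derivative f (at x) v"])
      (use Suc.prems frechet_derivative_eqI[OF D] in auto)
  then show ?case using D by (auto simp: differentiable_def)
qed

text \<open>Lets an explicit formula for the derivative stand in for
  \<open>frechet_derivative\<close>; the closure rules supply such a formula and induct on the
  order.\<close>

lemma C_k_on_SucI:
  assumes "open S" "\<And>x. x \<in> S \<Longrightarrow> (f has_derivative f' x) (at x)"
    and "\<And>v. C_k_on k S (\<lambda>x. f' x v)"
  shows "C_k_on (Suc k) S f"
proof -
  have "C_k_on k S (\<lambda>x. frechet_derivative f (at x) v)" for v
    using C_k_on_cong[OF assms(1) _ assms(3)[of v]] frechet_derivative_eqI[OF assms(2)] by simp
  then show ?thesis using assms(2) by (auto simp: differentiable_def)
qed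

lemma C_k_on_Suc_imp: "C_k_on (Suc k) S f \<Longrightarrow> C_k_on k S f"
proof (induction k arbitrary: f)
  case 0
  then show ?case
    by (auto intro!: continuous_at_imp_continuous_on differentiable_imp_continuous_within)
next
  case (Suc k)
  then show ?case by (metis C_k_on.simps(2))
qed

lemma C_k_on_const: "open S \<Longrightarrow> C_k_on k S (\<lambda>x. c)"
proof (induction k arbitrary: c)
  case (Suc k)
  show ?case by (rule C_k_on_SucI[OF Suc.prems, of _ "\<lambda>x v. 0"]) (use Suc in auto)
qed simp

lemma C_k_on_bounded_linear:
  assumes "open S" "bounded_linear h" "C_k_on k S f"
  shows "C_k_on k S (\<lambda>x. h (f x))"
  using assms(3)
proof (induction k arbitrary: f)
  case 0
  then show ?case
    by (auto intro: continuous_on_compose2[OF linear_continuous_on[OF assms(2), of UNIV]])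
next
  case (Suc k)
  show ?case
    by (rule C_k_on_SucI[OF assms(1), of _ "\<lambda>x v. h (frechet_derivative f (at x) v)"])
      (use Suc in \<open>auto intro!: bounded_linear.has_derivative[OF assms(2)] simp: frechet_derivative_works\<close>)
qed

lemma C_k_on_add:
  assumes "open S" "C_k_on k S f" "C_k_on k S g"
  shows "C_k_on k S (\<lambda>x. f x + g x)"
  using assms(2,3)
proof (induction k arbitrary: f g)
  case 0
  then show ?case by (auto intro: continuous_on_add)
next
  case (Suc k)
  show ?case
    by (rule C_k_on_SucI[OF assms(1),
          of _ "\<lambda>x v. frechet_derivative f (at x) v + frechet_derivative g (at x) v"])
      (use Suc in \<open>auto intro!: has_derivative_add simp: frechet_derivative_works\<close>)
qed

text \<open>The product rule leaves one factor undifferentiated in each summand, so the induction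
  hypothesis is applied to pairs made of one function and a derivative of the other.\<close>

lemma C_k_on_bilinear:
  assumes "open S" "bounded_bilinear h" "C_k_on k S f" "C_k_on k S g"
  shows "C_k_on k S (\<lambda>x. h (f x) (g x))"
  using assms(3,4)
proof (induction k arbitrary: f g)
  case 0
  then show ?case by (auto intro: bounded_bilinear.continuous_on[OF assms(2)])
next
  case (Suc k)
  have "C_k_on k S f" "C_k_on k S g" using Suc.prems C_k_on_Suc_imp by blast+
  moreover have "C_k_on k S (\<lambda>x. frechet_derivative f (at x) v)"
    "C_k_on k S (\<lambda>x. frechet_derivative g (at x) v)" for v
    using Suc.prems by simp_all
  ultimately have C: "C_k_on k S (\<lambda>x. h (f x) (frechet_derivative g (at x) v)
      + h (frechet_derivative f (at x) v) (g x))" for v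
    by (intro C_k_on_add[OF assms(1)] Suc.IH)
  have D: "((\<lambda>x. h (f x) (g x)) has_derivative (\<lambda>v. h (f x) (frechet_derivative g (at x) v)
      + h (frechet_derivative f (at x) v) (g x))) (at x)" if "x \<in> S" for x
    by (rule bounded_bilinear.FDERIV[OF assms(2)])
      (use Suc.prems that in \<open>simp_all add: frechet_derivative_works\<close>)
  show ?case by (rule C_k_on_SucI[OF assms(1) D C])
qed

text \<open>The derivative of 1/f contains 1/f again, whose regularity one order lower is the
  induction hypothesis.\<close>

lemma C_k_on_inverse:
  fixes f :: "'a::euclidean_space \<Rightarrow> real"
  assumes "open S" "\<And>x. x \<in> S \<Longrightarrow> f x \<noteq> 0" "C_k_on k S f"
  shows "C_k_on k S (\<lambda>x. inverse (f x))"
  using assms(3)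
proof (induction k)
  case 0
  then show ?case using assms(2) by (auto intro: continuous_on_inverse)
next
  case (Suc k)
  have inv: "C_k_on k S (\<lambda>x. inverse (f x))" using Suc C_k_on_Suc_imp by blast
  have "C_k_on k S (\<lambda>x. frechet_derivative f (at x) v)" for v
    using Suc.prems by simp
  with inv have "C_k_on k S (\<lambda>x. - (inverse (f x) * frechet_derivative f (at x) v * inverse (f x)))" for v
    by (intro C_k_on_bilinear[OF assms(1) bounded_bilinear_mult]
        C_k_on_bounded_linear[OF assms(1) bounded_linear_minus[OF bounded_linear_ident]])
  moreover have "((\<lambda>x. inverse (f x)) has_derivative
      (\<lambda>v. - (inverse (f x) * frechet_derivative f (at x) v * inverse (f x)))) (at x)"
    if "x \<in> S" for x
    by (rule Deriv.has_derivative_inverse)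
      (use Suc.prems assms(2) that in \<open>simp_all add: frechet_derivative_works\<close>)
  ultimately show ?case by (intro C_k_on_SucI[OF assms(1)])
qed

lemma C_k_on_id: "open S \<Longrightarrow> C_k_on k S (\<lambda>x. x)"
proof (cases k)
  case (Suc k)
  assume "open S"
  then show ?thesis unfolding Suc
    by (intro C_k_on_SucI[of _ _ "\<lambda>x v. v"] C_k_on_const) auto
qed (simp add: continuous_on_id)

context
  fixes S :: "'a::euclidean_space set"
  assumes S: "open S"
begin

lemma smooth_on_const: "smooth_on S (\<lambda>x. c)"
  and smooth_on_id: "smooth_on S (\<lambda>x. x)"
  by (simp_all add: smooth_on_def C_k_on_const[OF S] C_k_on_id[OF S])

lemma smooth_on_bounded_linear: "bounded_linear h \<Longrightarrow> smooth_on S f \<Longrightarrow> smooth_on S (\<lambda>x. h (f x))"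
  by (simp add: smooth_on_def C_k_on_bounded_linear[OF S])

lemma smooth_on_add: "smooth_on S f \<Longrightarrow> smooth_on S g \<Longrightarrow> smooth_on S (\<lambda>x. f x + g x)"
  by (simp add: smooth_on_def C_k_on_add[OF S])

lemma smooth_on_diff: "smooth_on S f \<Longrightarrow> smooth_on S g \<Longrightarrow> smooth_on S (\<lambda>x. f x - g x)"
  using smooth_on_add[of f "\<lambda>x. - g x"]
    smooth_on_bounded_linear[OF bounded_linear_minus[OF bounded_linear_ident], of g] by simp

lemma smooth_on_bilinear:
  "bounded_bilinear h \<Longrightarrow> smooth_on S f \<Longrightarrow> smooth_on S g \<Longrightarrow> smooth_on S (\<lambda>x. h (f x) (g x))"
  by (simp add: smooth_on_def C_k_on_bilinear[OF S])

lemmas smooth_on_mult = smooth_on_bilinear[OF bounded_bilinear_mult]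
  and smooth_on_scaleR = smooth_on_bilinear[OF bounded_bilinear_scaleR]
  and smooth_on_inner = smooth_on_bilinear[OF bounded_bilinear_inner]

lemma smooth_on_inverse:
  fixes f :: "'a \<Rightarrow> real"
  shows "(\<And>x. x \<in> S \<Longrightarrow> f x \<noteq> 0) \<Longrightarrow> smooth_on S f \<Longrightarrow> smooth_on S (\<lambda>x. inverse (f x))"
  by (simp add: smooth_on_def C_k_on_inverse[OF S])

lemma smooth_on_divide:
  fixes f g :: "'a \<Rightarrow> real"
  shows "(\<And>x. x \<in> S \<Longrightarrow> g x \<noteq> 0) \<Longrightarrow> smooth_on S f \<Longrightarrow> smooth_on S g \<Longrightarrow> smooth_on S (\<lambda>x. f x / g x)"
  by (simp add: divide_inverse smooth_on_mult smooth_on_inverse)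

end

lemma smooth_on_has_derivative:
  assumes "smooth_on S f" "x \<in> S"
  shows "(f has_derivative frechet_derivative f (at x)) (at x)"
  using assms unfolding smooth_on_def by (metis C_k_on.simps(2) frechet_derivative_works)

lemma smooth_on_frechet_derivative:
  "smooth_on S f \<Longrightarrow> smooth_on S (\<lambda>x. frechet_derivative f (at x) v)"
  unfolding smooth_on_def by (metis C_k_on.simps(2))

lemma smooth_on_continuous_on: "smooth_on S f \<Longrightarrow> continuous_on S f"
  unfolding smooth_on_def by (metis C_k_on.simps(1))

section \<open>Symmetry of second derivatives\<close>

text \<open>The mean value theorem is applied twice: along \<open>u\<close> to the difference of
  \<open>f\<close> across the two sides of a parallelogram, then along \<open>z\<close> to the
  derivative in direction \<open>u\<close>. The bound on \<open>h\<close> keeps the parallelogram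
  inside the ball.\<close>

lemma second_difference:
  fixes f :: "'a::euclidean_space \<Rightarrow> real"
  assumes f: "smooth_on S f" and S: "ball y r \<subseteq> S"
    and h: "0 < h" "h * (norm u + norm z) < r"
  obtains p where "p \<in> ball y r"
    "f (y + h *\<^sub>R u + h *\<^sub>R z) - f (y + h *\<^sub>R u) - f (y + h *\<^sub>R z) + f y
      = h\<^sup>2 * frechet_derivative (\<lambda>x. frechet_derivative f (at x) u) (at p) z"
proof -
  have inb: "y + a *\<^sub>R u + c *\<^sub>R z \<in> ball y r" if "0 \<le> a" "a \<le> h" "0 \<le> c" "c \<le> h" for a c
  proof -
    have "norm (a *\<^sub>R u + c *\<^sub>R z) \<le> a * norm u + c * norm z"
      using that norm_triangle_ineq[of "a *\<^sub>R u" "c *\<^sub>R z"] by simp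
    also have "\<dots> \<le> h * norm u + h * norm z" using that by (intro add_mono mult_right_mono) auto
    finally have "norm (a *\<^sub>R u + c *\<^sub>R z) < r" using h(2) by (simp add: distrib_left)
    then show ?thesis using norm_minus_cancel[of "a *\<^sub>R u + c *\<^sub>R z"]
      by (simp add: mem_ball dist_norm add.assoc norm_minus_commute)
  qed
  let ?D = "\<lambda>x. frechet_derivative f (at x) u"
  let ?\<phi> = "\<lambda>a. f (y + a *\<^sub>R u + h *\<^sub>R z) - f (y + a *\<^sub>R u + 0 *\<^sub>R z)"
  have line: "((\<lambda>a. F (y + a *\<^sub>R u + c *\<^sub>R z)) has_real_derivative frechet_derivative F (at (y + a *\<^sub>R u + c *\<^sub>R z)) u) (at a)"
    if "0 \<le> a" "a \<le> h" "0 \<le> c" "c \<le> h" "smooth_on S F" for F :: "'a \<Rightarrow> real" and a c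
  proof -
    have "y + a *\<^sub>R u + c *\<^sub>R z \<in> S" using inb that S by blast
    note D = smooth_on_has_derivative[OF that(5) this]
    have "((\<lambda>a. y + a *\<^sub>R u + c *\<^sub>R z) has_derivative (\<lambda>t. t *\<^sub>R u)) (at a)"
      by (auto intro!: derivative_eq_intros)
    from has_derivative_compose[OF this D] show ?thesis
      by (simp add: has_real_derivative_iff_has_vector_derivative has_vector_derivative_def
          linear_cmul[OF has_derivative_linear[OF D]])
  qed
  have "\<exists>a>0. a < h \<and> ?\<phi> h - ?\<phi> 0 = (h - 0) * (?D (y + a *\<^sub>R u + h *\<^sub>R z) - ?D (y + a *\<^sub>R u + 0 *\<^sub>R z))"
    by (intro MVT2 DERIV_diff line) (use h f in auto)
  then obtain a where a: "0 < a" "a < h"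
    "?\<phi> h - ?\<phi> 0 = h * (?D (y + a *\<^sub>R u + h *\<^sub>R z) - ?D (y + a *\<^sub>R u + 0 *\<^sub>R z))" by auto
  let ?DD = "\<lambda>p. frechet_derivative ?D (at p) z"
  have line2: "((\<lambda>c. ?D (y + a *\<^sub>R u + c *\<^sub>R z)) has_real_derivative ?DD (y + a *\<^sub>R u + c *\<^sub>R z)) (at c)"
    if "0 \<le> c" "c \<le> h" for c
  proof -
    have "y + a *\<^sub>R u + c *\<^sub>R z \<in> S" using inb that S a by (meson less_imp_le subsetD)
    note D = smooth_on_has_derivative[OF smooth_on_frechet_derivative[OF f, of u] this]
    have "((\<lambda>c. y + a *\<^sub>R u + c *\<^sub>R z) has_derivative (\<lambda>t. t *\<^sub>R z)) (at c)"
      by (auto intro!: derivative_eq_intros)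
    from has_derivative_compose[OF this D] show ?thesis
      by (simp add: has_real_derivative_iff_has_vector_derivative has_vector_derivative_def
          linear_cmul[OF has_derivative_linear[OF D]])
  qed
  have "\<exists>c>0. c < h \<and> ?D (y + a *\<^sub>R u + h *\<^sub>R z) - ?D (y + a *\<^sub>R u + 0 *\<^sub>R z)
      = (h - 0) * ?DD (y + a *\<^sub>R u + c *\<^sub>R z)"
    by (intro MVT2 line2) (use h in auto)
  then obtain c where c: "0 < c" "c < h"
    "?D (y + a *\<^sub>R u + h *\<^sub>R z) - ?D (y + a *\<^sub>R u + 0 *\<^sub>R z) = h * ?DD (y + a *\<^sub>R u + c *\<^sub>R z)"
    by auto
  show thesis
  proof (rule that)
    show "y + a *\<^sub>R u + c *\<^sub>R z \<in> ball y r" using inb a c by (simp add: less_imp_le)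
    show "f (y + h *\<^sub>R u + h *\<^sub>R z) - f (y + h *\<^sub>R u) - f (y + h *\<^sub>R z) + f y
      = h\<^sup>2 * ?DD (y + a *\<^sub>R u + c *\<^sub>R z)"
      using a(3) c(3) by (simp add: power2_eq_square)
  qed
qed

text \<open>The second difference does not change when \<open>u\<close> and \<open>z\<close> are
  exchanged, so the two mixed derivatives agree at some points \<open>p\<close> and \<open>q\<close>
  arbitrarily close to \<open>y\<close>; continuity brings this to \<open>y\<close>.\<close>

lemma second_derivative_symmetric_real:
  fixes f :: "'a::euclidean_space \<Rightarrow> real"
  assumes f: "smooth_on S f" and S: "open S" "y \<in> S"
  shows "frechet_derivative (\<lambda>x. frechet_derivative f (at x) u) (at y) z
       = frechet_derivative (\<lambda>x. frechet_derivative f (at x) z) (at y) u"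
proof (rule ccontr)
  define F where "F = (\<lambda>u z p. frechet_derivative (\<lambda>x. frechet_derivative f (at x) u) (at p) z)"
  assume "\<not> ?thesis"
  then have ne: "F u z y \<noteq> F z u y" by (simp add: F_def)
  have c: "continuous (at y) (F u z)" for u z
    using smooth_on_continuous_on[OF smooth_on_frechet_derivative[OF smooth_on_frechet_derivative[OF f]]]
      S unfolding F_def by (simp add: continuous_on_eq_continuous_at)
  \<comment> \<open>Half of the supposed gap: values within \<open>e\<close> of
    \<open>F u z y\<close> and of \<open>F z u y\<close> cannot coincide.\<close>
  define e where "e = dist (F u z y) (F z u y) / 2"
  have e: "e > 0" using ne by (simp add: e_def)
  obtain d1 where d1: "d1 > 0" "\<And>p. dist p y < d1 \<Longrightarrow> dist (F u z p) (F u z y) < e"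
    using c[of u z] e unfolding continuous_at_eps_delta by blast
  obtain d2 where d2: "d2 > 0" "\<And>p. dist p y < d2 \<Longrightarrow> dist (F z u p) (F z u y) < e"
    using c[of z u] e unfolding continuous_at_eps_delta by blast
  obtain d3 where d3: "d3 > 0" "ball y d3 \<subseteq> S" using S open_contains_ball by blast
  define r where "r = min d1 (min d2 d3)"
  have r: "r > 0" "ball y r \<subseteq> S" using d1 d2 d3 by (auto simp: r_def)
  \<comment> \<open>The summand 1 keeps the denominator positive even if both directions
    vanish.\<close>
  define h where "h = r / (norm u + norm z + 1)"
  have n: "norm u + norm z \<ge> 0" by simp
  have "r * (norm u + norm z) < r * (norm u + norm z + 1)" using r(1) by simp
  moreover have "norm u + norm z + 1 > 0" using n by linarith
  ultimately have h: "h > 0" "h * (norm u + norm z) < r"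
    using r(1) by (simp_all only: h_def times_divide_eq_left pos_divide_less_eq divide_pos_pos)
  obtain p where p: "p \<in> ball y r"
    "f (y + h *\<^sub>R u + h *\<^sub>R z) - f (y + h *\<^sub>R u) - f (y + h *\<^sub>R z) + f y = h\<^sup>2 * F u z p"
    using second_difference[OF f r(2) h] unfolding F_def by metis
  obtain q where q: "q \<in> ball y r"
    "f (y + h *\<^sub>R z + h *\<^sub>R u) - f (y + h *\<^sub>R z) - f (y + h *\<^sub>R u) + f y = h\<^sup>2 * F z u q"
    using second_difference[OF f r(2) h(1), of z u] h(2) unfolding F_def by (metis add.commute)
  have "h\<^sup>2 * F u z p = h\<^sup>2 * F z u q"
    unfolding p(2)[symmetric] q(2)[symmetric] by (simp add: algebra_simps)
  then have "F u z p = F z u q" using h(1) by simp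
  moreover have "dist (F u z p) (F u z y) < e" "dist (F z u q) (F z u y) < e"
    using p(1) q(1) d1(2)[of p] d2(2)[of q] by (auto simp: r_def dist_commute)
  ultimately show False unfolding e_def dist_real_def by argo
qed

lemma second_derivative_symmetric:
  fixes f :: "'a::euclidean_space \<Rightarrow> 'b::euclidean_space"
  assumes f: "smooth_on S f" and S: "open S" "y \<in> S"
  shows "frechet_derivative (\<lambda>x. frechet_derivative f (at x) u) (at y) z
       = frechet_derivative (\<lambda>x. frechet_derivative f (at x) z) (at y) u"
proof (rule euclidean_eqI)
  fix e :: 'b assume "e \<in> Basis"
  have fe: "smooth_on S (\<lambda>x. f x \<bullet> e)"
    by (rule smooth_on_bounded_linear[OF S(1) bounded_linear_inner_left f])
  have 1: "frechet_derivative (\<lambda>x. f x \<bullet> e) (at x) u = frechet_derivative f (at x) u \<bullet> e" if "x \<in> S" for x u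
    using frechet_derivative_eqI[OF bounded_linear.has_derivative[OF bounded_linear_inner_left
      smooth_on_has_derivative[OF f that], of e]] by simp
  have "frechet_derivative (\<lambda>x. frechet_derivative (\<lambda>x. f x \<bullet> e) (at x) u) (at y) z
     = frechet_derivative (\<lambda>x. frechet_derivative f (at x) u) (at y) z \<bullet> e" for u z
  proof -
    have "((\<lambda>x. frechet_derivative f (at x) u \<bullet> e) has_derivative
        (\<lambda>z. frechet_derivative (\<lambda>x. frechet_derivative f (at x) u) (at y) z \<bullet> e)) (at y)"
      by (rule bounded_linear.has_derivative[OF bounded_linear_inner_left
            smooth_on_has_derivative[OF smooth_on_frechet_derivative[OF f] S(2)]])
    from has_derivative_transform_within_open[OF this S 1[symmetric]]
    show ?thesis by (simp add: frechet_derivative_eqI)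
  qed
  then show "frechet_derivative (\<lambda>x. frechet_derivative f (at x) u) (at y) z \<bullet> e
       = frechet_derivative (\<lambda>x. frechet_derivative f (at x) z) (at y) u \<bullet> e"
    using second_derivative_symmetric_real[OF fe S, of u z] by simp
qed

section \<open>Geodesics of submanifolds in ambient terms\<close>

text \<open>Joint differentiability of \<open>F\<close> is not among the assumptions. Expanding the
  second argument in the basis turns \<open>F (p z) (A z)\<close> into a finite sum of products,
  each differentiable because its argument of \<open>F\<close> is a fixed basis vector.\<close>

lemma has_derivative_linear_family:
  fixes F :: "'a::real_normed_vector \<Rightarrow> 'b::euclidean_space \<Rightarrow> 'c::real_normed_vector"
    and p :: "'d::real_normed_vector \<Rightarrow> 'a"
  assumes lin: "\<forall>\<^sub>F z in at y. linear (F (p z))" "linear (F (p y))"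
    and F: "\<And>v. (\<lambda>x. F x v) differentiable (at (p y))"
    and p: "(p has_derivative p') (at y)" and A: "(A has_derivative A') (at y)"
  shows "((\<lambda>z. F (p z) (A z)) has_derivative
    (\<lambda>z. frechet_derivative (\<lambda>x. F x (A y)) (at (p y)) (p' z) + F (p y) (A' z))) (at y)"
proof -
  let ?D = "\<lambda>v. frechet_derivative (\<lambda>x. F x v) (at (p y))"
  have expand: "(\<Sum>i\<in>Basis. (v \<bullet> i) *\<^sub>R F x i) = F x v" if "linear (F x)" for x v
    using linear_sum[OF that, of "\<lambda>i. (v \<bullet> i) *\<^sub>R i" Basis]
    by (simp add: linear_cmul[OF that] euclidean_representation)
  have D: "((\<lambda>z. F (p z) v) has_derivative (\<lambda>z. ?D v (p' z))) (at y)" for v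
    using has_derivative_compose[OF p] F frechet_derivative_works by blast
  have sum: "((\<lambda>z. \<Sum>i\<in>Basis. (B z \<bullet> i) *\<^sub>R F (p z) i) has_derivative
      (\<lambda>z. \<Sum>i\<in>Basis. (B y \<bullet> i) *\<^sub>R ?D i (p' z) + (B' z \<bullet> i) *\<^sub>R F (p y) i)) (at y)"
    if "(B has_derivative B') (at y)" for B B'
    by (intro has_derivative_sum has_derivative_scaleR D
        bounded_linear.has_derivative[OF bounded_linear_inner_left that])
  have transfer: "((\<lambda>z. F (p z) (B z)) has_derivative
      (\<lambda>z. \<Sum>i\<in>Basis. (B y \<bullet> i) *\<^sub>R ?D i (p' z) + (B' z \<bullet> i) *\<^sub>R F (p y) i)) (at y)"
    if "(B has_derivative B') (at y)" for B B'
    by (rule has_derivative_transform_eventually[OF sum[OF that]])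
      (use lin in \<open>auto simp: expand elim: eventually_mono\<close>)
  \<comment> \<open>Differentiating with the constant argument \<open>A y\<close> in two ways shows
    that the basis sum of the \<open>?D i\<close> is \<open>?D (A y)\<close>, a linearity that
    \<open>frechet_derivative\<close> does not give by itself.\<close>
  have "?D (A y) (p' z) = (\<Sum>i\<in>Basis. (A y \<bullet> i) *\<^sub>R ?D i (p' z))" for z
    using fun_cong[OF has_derivative_unique[OF D[of "A y"] transfer[OF has_derivative_const[of "A y"]]]]
    by simp
  then show ?thesis
    using transfer[OF A] by (simp add: sum.distrib expand lin)
qed

lemma riemannian_metric_onD:
  assumes "riemannian_metric_on M g" "x \<in> M"
  shows "linear (g x u)" "linear (\<lambda>u. g x u v)" "g x u v = g x v u"
    "(\<lambda>x. g x u v) differentiable (at x)"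
  using assms smooth_on_has_derivative[of M "\<lambda>x. g x u v" x]
  unfolding riemannian_metric_on_def bilinear_def differentiable_def by blast+

text \<open>The rule for linear families is used once for each slot of the metric. Linearity of
  \<open>g (p z)\<close> is known only while \<open>p z\<close> lies in \<open>M\<close>, hence for
  \<open>z\<close> near \<open>y\<close>.\<close>

lemma has_derivative_metric:
  fixes p :: "'d::real_normed_vector \<Rightarrow> 'a::euclidean_space"
  assumes g: "riemannian_metric_on M g" and y: "p y \<in> M"
    and p: "(p has_derivative p') (at y)"
    and A: "(A has_derivative A') (at y)" and B: "(B has_derivative B') (at y)"
  shows "((\<lambda>z. g (p z) (A z) (B z)) has_derivative
    (\<lambda>z. frechet_derivative (\<lambda>x. g x (A y) (B y)) (at (p y)) (p' z)
        + g (p y) (A y) (B' z) + g (p y) (A' z) (B y))) (at y)"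
proof -
  have "open M" using g by (simp add: riemannian_metric_on_def)
  then have M: "\<forall>\<^sub>F z in at y. p z \<in> M"
    using has_derivative_continuous[OF p] y topological_tendstoD
    unfolding continuous_at by blast
  have 1: "((\<lambda>z. g (p z) v (B z)) has_derivative
      (\<lambda>z. frechet_derivative (\<lambda>x. g x v (B y)) (at (p y)) (p' z) + g (p y) v (B' z))) (at y)" for v
    by (rule has_derivative_linear_family[of "\<lambda>x. g x v", OF _ _ _ p B])
      (use M y riemannian_metric_onD[OF g] in \<open>auto elim: eventually_mono\<close>)
  \<comment> \<open>Second slot already done: the base point and \<open>B\<close> together now form
    a family in \<open>z\<close>, linear in the first slot, with the identity as inner map.\<close>
  have "((\<lambda>z. g (p z) (A z) (B z)) has_derivative
      (\<lambda>z. frechet_derivative (\<lambda>z. g (p z) (A y) (B z)) (at y) z + g (p y) (A' z) (B y))) (at y)"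
    by (rule has_derivative_linear_family[of "\<lambda>z u. g (p z) u (B z)", OF _ _ _ has_derivative_ident A])
      (use M y riemannian_metric_onD(2)[OF g] differentiableI[OF 1] in \<open>auto elim: eventually_mono\<close>)
  then show ?thesis by (simp add: frechet_derivative_eqI[OF 1])
qed

text \<open>Differentiating the pullback yields second derivatives of \<open>\<theta>\<close> in the
  pairs (u, u), (w, u) and (u, w). The last two enter with opposite signs and cancel by symmetry;
  the first survives as the correction term, which is part of the ambient acceleration.\<close>

lemma christoffel_first_pullback:
  assumes g: "riemannian_metric_on M g" and \<theta>: "smooth_on V \<theta>" "open V"
    and y: "y \<in> V" "\<theta> y \<in> M"
  shows "christoffel_first (pullback_metric \<theta> g) y u u w
    = christoffel_first g (\<theta> y) (frechet_derivative \<theta> (at y) u) (frechet_derivative \<theta> (at y) u)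
        (frechet_derivative \<theta> (at y) w)
      + g (\<theta> y) (frechet_derivative (\<lambda>y. frechet_derivative \<theta> (at y) u) (at y) u)
          (frechet_derivative \<theta> (at y) w)"
proof -
  let ?T = "\<lambda>u. frechet_derivative \<theta> (at y) u"
  let ?H = "\<lambda>u z. frechet_derivative (\<lambda>y. frechet_derivative \<theta> (at y) u) (at y) z"
  have "frechet_derivative (\<lambda>y. pullback_metric \<theta> g y u v) (at y) z
     = frechet_derivative (\<lambda>x. g x (?T u) (?T v)) (at (\<theta> y)) (?T z)
       + g (\<theta> y) (?T u) (?H v z) + g (\<theta> y) (?H u z) (?T v)" for u v z
    unfolding pullback_metric_def
    by (rule fun_cong[OF frechet_derivative_eqI[OF has_derivative_metric[of M g \<theta>, OF g y(2)]]])
      (use smooth_on_has_derivative[OF \<theta>(1) y(1)]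
        smooth_on_has_derivative[OF smooth_on_frechet_derivative[OF \<theta>(1)] y(1)] in auto)
  moreover have "?H u w = ?H w u"
    by (rule second_derivative_symmetric[OF \<theta> y(1)])
  ultimately show ?thesis
    using riemannian_metric_onD(3)[OF g y(2)]
    by (simp add: christoffel_first_def field_simps)
qed

section \<open>Tangent spaces and the geodesic equation without charts\<close>

text \<open>Curves are only required to be differentiable at 0, so membership can be shown by any
  convenient curve and exploited by differentiating any equation valid on \<open>S\<close>.\<close>

definition tangent_space :: "'a::real_normed_vector set \<Rightarrow> 'a \<Rightarrow> 'a set" where
  "tangent_space S p =
     {w. \<exists>\<eta>. \<eta> (0::real) = p \<and> (\<eta> has_vector_derivative w) (at 0) \<and> (\<forall>\<^sub>F s in at 0. \<eta> s \<in> S)}"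

text \<open>A subspace is its own double orthogonal complement, and every linear functional
  vanishing on \<open>L\<close> vanishes along the curve.\<close>

lemma vector_derivative_in_subspace:
  fixes \<gamma> :: "real \<Rightarrow> 'a::euclidean_space"
  assumes "subspace L" "(\<gamma> has_vector_derivative v) (at t)" "\<forall>\<^sub>F s in at t. \<gamma> s \<in> L" "\<gamma> t \<in> L"
  shows "v \<in> L"
proof -
  have "n \<bullet> v = 0" if "n \<in> orthogonal_comp L" for n
  proof -
    have 0: "n \<bullet> x = 0" if "x \<in> L" for x
      using that \<open>n \<in> _\<close> by (auto simp: orthogonal_comp_def orthogonal_def inner_commute)
    have "((\<lambda>s. n \<bullet> \<gamma> s) has_derivative (\<lambda>s. n \<bullet> (s *\<^sub>R v))) (at t)"
      using assms(2) by (intro bounded_linear.has_derivative[OF bounded_linear_inner_right])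
        (simp add: has_vector_derivative_def)
    moreover have "((\<lambda>s. n \<bullet> \<gamma> s) has_derivative (\<lambda>s. 0)) (at t)"
      by (rule has_derivative_transform_eventually[OF has_derivative_const[of 0]])
        (use assms 0 in \<open>auto elim: eventually_mono\<close>)
    ultimately have "(\<lambda>s::real. n \<bullet> (s *\<^sub>R v)) = (\<lambda>s. 0)" by (rule has_derivative_unique)
    from fun_cong[OF this, of 1] show ?thesis by simp
  qed
  then have "v \<in> orthogonal_comp (orthogonal_comp L)"
    unfolding orthogonal_comp_def[of "orthogonal_comp L"] by (auto simp: orthogonal_def inner_commute)
  then show ?thesis using orthogonal_comp_self[OF assms(1)] by simp
qed

lemma eventually_curve_in_open:
  assumes "(\<eta> has_vector_derivative w) (at t)" "open U" "\<eta> t \<in> U"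
  shows "\<forall>\<^sub>F s in at t. \<eta> s \<in> U"
  using has_vector_derivative_continuous[OF assms(1)] assms(2,3) topological_tendstoD
  unfolding continuous_at by blast

lemma has_vector_derivative_comp_frechet:
  assumes "smooth_on V \<theta>" "\<gamma> t \<in> V" "(\<gamma> has_vector_derivative v) (at t)"
  shows "((\<lambda>s. \<theta> (\<gamma> s)) has_vector_derivative frechet_derivative \<theta> (at (\<gamma> t)) v) (at t)"
proof -
  note D = smooth_on_has_derivative[OF assms(1,2)]
  show ?thesis
    using has_derivative_compose[OF assms(3)[unfolded has_vector_derivative_def] D]
    by (simp add: has_vector_derivative_def linear_cmul[OF has_derivative_linear[OF D]])
qed

text \<open>A curve in \<open>S\<close> is pulled back by \<open>\<psi>\<close> to a curve in
  \<open>L\<close>, whose velocity lies in \<open>L\<close>; conversely, segments y + s l are pushed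
  forward by \<open>\<theta>\<close>.\<close>

lemma tangent_space_slice_chart:
  assumes chart: "slice_chart S L V \<theta>" and y: "y \<in> V" "y \<in> L"
  shows "tangent_space S (\<theta> y) = frechet_derivative \<theta> (at y) ` L"
proof -
  obtain \<psi> where L: "subspace L" and V: "open V" "open (\<theta> ` V)" and \<theta>: "smooth_on V \<theta>"
    and \<psi>: "smooth_on (\<theta> ` V) \<psi>" "\<And>y. y \<in> V \<Longrightarrow> \<psi> (\<theta> y) = y"
    and S: "\<theta> ` (V \<inter> L) = S \<inter> \<theta> ` V"
    using chart unfolding slice_chart_def by blast
  show ?thesis
  proof (intro equalityI subsetI)
    fix w assume "w \<in> tangent_space S (\<theta> y)"
    then obtain \<eta> where \<eta>: "\<eta> 0 = \<theta> y" "(\<eta> has_vector_derivative w) (at 0)" "\<forall>\<^sub>F s in at 0. \<eta> s \<in> S"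
      unfolding tangent_space_def by blast
    let ?\<gamma> = "\<lambda>s. \<psi> (\<eta> s)"
    let ?l = "frechet_derivative \<psi> (at (\<eta> 0)) w"
    have l: "(?\<gamma> has_vector_derivative ?l) (at 0)"
      by (rule has_vector_derivative_comp_frechet[OF \<psi>(1) _ \<eta>(2)]) (use y \<eta> in auto)
    have ev: "\<forall>\<^sub>F s in at 0. \<eta> s \<in> \<theta> ` (V \<inter> L)"
      using eventually_conj[OF \<eta>(3) eventually_curve_in_open[OF \<eta>(2) V(2)]] \<eta>(1) y S by auto
    have "?l \<in> L"
      by (rule vector_derivative_in_subspace[OF L l])
        (use ev \<psi>(2) \<eta>(1) y in \<open>auto elim: eventually_mono\<close>)
    \<comment> \<open>Near 0 the curve \<open>\<theta> (?\<gamma> s)\<close> is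
      \<open>\<eta> s\<close> again, so uniqueness of the derivative identifies its velocity with
      \<open>w\<close>.\<close>
    moreover have "((\<lambda>s. \<theta> (?\<gamma> s)) has_vector_derivative frechet_derivative \<theta> (at (?\<gamma> 0)) ?l) (at 0)"
      by (rule has_vector_derivative_comp_frechet[OF \<theta> _ l]) (use y \<eta> \<psi> in auto)
    then have "((\<lambda>s. \<theta> (?\<gamma> s)) has_derivative (\<lambda>s. s *\<^sub>R frechet_derivative \<theta> (at y) ?l)) (at 0)"
      using \<eta>(1) \<psi>(2) y by (simp add: has_vector_derivative_def)
    then have "(\<eta> has_vector_derivative frechet_derivative \<theta> (at y) ?l) (at 0)"
      unfolding has_vector_derivative_def
      by (rule has_derivative_transform_eventually)
        (use ev \<eta>(1) \<psi>(2) y in \<open>auto elim: eventually_mono\<close>)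
    then have "w = frechet_derivative \<theta> (at y) ?l"
      using \<eta>(2) vector_derivative_unique_at by blast
    ultimately show "w \<in> frechet_derivative \<theta> (at y) ` L" by blast
  next
    fix w assume "w \<in> frechet_derivative \<theta> (at y) ` L"
    then obtain l where l: "l \<in> L" "w = frechet_derivative \<theta> (at y) l" by blast
    have d: "((\<lambda>s. y + s *\<^sub>R l) has_vector_derivative l) (at 0)"
      by (auto intro!: derivative_eq_intros)
    have "((\<lambda>s. \<theta> (y + s *\<^sub>R l)) has_vector_derivative w) (at 0)"
      using has_vector_derivative_comp_frechet[OF \<theta> _ d] y l by simp
    moreover have "\<theta> (y + s *\<^sub>R l) \<in> S" if "y + s *\<^sub>R l \<in> V" for s
      using that S y l L by (auto simp: subspace_add subspace_scale)
    then have "\<forall>\<^sub>F s in at 0. \<theta> (y + s *\<^sub>R l) \<in> S"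
      using eventually_curve_in_open[OF d V(1)] y by (auto elim: eventually_mono)
    ultimately show "w \<in> tangent_space S (\<theta> y)"
      unfolding tangent_space_def by (intro CollectI exI[of _ "\<lambda>s. \<theta> (y + s *\<^sub>R l)"]) auto
  qed
qed

lemma geodesic_equation_slice_chart:
  assumes chart: "slice_chart S L V \<theta>" and g: "riemannian_metric_on M g" and "S \<subseteq> M"
    and y: "y \<in> V" "y \<in> L"
  shows "(\<forall>w\<in>L. pullback_metric \<theta> g y a w + christoffel_first (pullback_metric \<theta> g) y v v w = 0) \<longleftrightarrow>
    (\<forall>w\<in>tangent_space S (\<theta> y).
      g (\<theta> y) (frechet_derivative (\<lambda>y. frechet_derivative \<theta> (at y) v) (at y) v
          + frechet_derivative \<theta> (at y) a) w
      + christoffel_first g (\<theta> y) (frechet_derivative \<theta> (at y) v) (frechet_derivative \<theta> (at y) v) w = 0)"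
proof -
  have *: "open V" "smooth_on V \<theta>" "\<theta> y \<in> M"
    using chart y \<open>S \<subseteq> M\<close> unfolding slice_chart_def by blast+
  show ?thesis
    unfolding tangent_space_slice_chart[OF chart y] ball_simps
      christoffel_first_pullback[OF g *(2,1) y(1) *(3)]
    by (simp add: pullback_metric_def linear_add[OF riemannian_metric_onD(2)[OF g *(3)]] algebra_simps)
qed

text \<open>Second-order chain rule along a curve, used for charts and for their inverses.\<close>

lemma has_vector_derivative_comp_frechet2:
  fixes \<theta> :: "'a::euclidean_space \<Rightarrow> 'b::real_normed_vector"
  assumes \<theta>: "smooth_on V \<theta>" "open V"
    and t: "\<gamma> t \<in> V" "(\<gamma> has_vector_derivative v t) (at t)" "(v has_vector_derivative a) (at t)"
  shows "((\<lambda>s. frechet_derivative \<theta> (at (\<gamma> s)) (v s)) has_vector_derivative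
     frechet_derivative (\<lambda>y. frechet_derivative \<theta> (at y) (v t)) (at (\<gamma> t)) (v t)
      + frechet_derivative \<theta> (at (\<gamma> t)) a) (at t)"
proof -
  note lin = has_derivative_linear[OF smooth_on_has_derivative[OF \<theta>(1)]]
  note D = smooth_on_has_derivative[OF smooth_on_frechet_derivative[OF \<theta>(1)] t(1)]
  have "((\<lambda>s. frechet_derivative \<theta> (at (\<gamma> s)) (v s)) has_derivative
     (\<lambda>s. frechet_derivative (\<lambda>y. frechet_derivative \<theta> (at y) (v t)) (at (\<gamma> t)) (s *\<^sub>R v t)
      + frechet_derivative \<theta> (at (\<gamma> t)) (s *\<^sub>R a))) (at t)"
    by (rule has_derivative_linear_family)
      (use t eventually_curve_in_open[OF t(2) \<theta>(2) t(1)] lin D in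
        \<open>auto elim: eventually_mono simp: has_vector_derivative_def differentiable_def\<close>)
  then show ?thesis
    by (simp add: has_vector_derivative_def linear_cmul[OF lin[OF t(1)]]
        linear_cmul[OF has_derivative_linear[OF D]] scaleR_add_right)
qed

text \<open>The sum of second-derivative term and image of the coordinate acceleration is the
  ambient acceleration, so no trace of the chart is left. This form is used for the ellipsoid under
  both metrics and for the punctured space.\<close>

lemma geodesic_on_iff_tangent_space:
  assumes g: "riemannian_metric_on M g" and S: "embedded_submanifold S" "S \<subseteq> M"
  shows "geodesic_on S g c I \<longleftrightarrow> open I \<and> is_interval I \<and> c ` I \<subseteq> S \<and>
    (\<exists>v a. \<forall>t\<in>I. (c has_vector_derivative v t) (at t) \<and> (v has_vector_derivative a t) (at t) \<and>
       (\<forall>w\<in>tangent_space S (c t). g (c t) (a t) w + christoffel_first g (c t) (v t) (v t) w = 0))"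
proof
  assume geo: "geodesic_on S g c I"
  \<comment> \<open>Chart-independent candidates: the charts differ from point to point, but a
    single \<open>v\<close> and \<open>a\<close> must serve on all of \<open>I\<close>.\<close>
  define v where "v = (\<lambda>t. vector_derivative c (at t))"
  define a where "a = (\<lambda>t. vector_derivative v (at t))"
  have "(c has_vector_derivative v t) (at t) \<and> (v has_vector_derivative a t) (at t) \<and>
       (\<forall>w\<in>tangent_space S (c t). g (c t) (a t) w + christoffel_first g (c t) (v t) (v t) w = 0)"
    if tI: "t \<in> I" for t
  proof -
    obtain J L V \<theta> \<gamma> where J: "open J" "t \<in> J" and chart: "slice_chart S L V \<theta>"
      and \<gamma>: "\<gamma> ` J \<subseteq> V \<inter> L" "\<forall>t\<in>J. c t = \<theta> (\<gamma> t)"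
        "geodesic_equation L (pullback_metric \<theta> g) \<gamma> J"
      using geo tI unfolding geodesic_on_def by meson
    have \<theta>: "smooth_on V \<theta>" "open V" using chart unfolding slice_chart_def by blast+
    obtain u b where ub: "\<And>t. t \<in> J \<Longrightarrow> (\<gamma> has_vector_derivative u t) (at t)"
      "\<And>t. t \<in> J \<Longrightarrow> (u has_vector_derivative b t) (at t)"
      "\<And>t w. t \<in> J \<Longrightarrow> w \<in> L \<Longrightarrow> pullback_metric \<theta> g (\<gamma> t) (b t) w
          + christoffel_first (pullback_metric \<theta> g) (\<gamma> t) (u t) (u t) w = 0"
      using \<gamma>(3) unfolding geodesic_equation_def by blast
    have c1: "(c has_vector_derivative frechet_derivative \<theta> (at (\<gamma> s)) (u s)) (at s)" if "s \<in> J" for s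
      by (rule has_vector_derivative_transform_within_open[OF
            has_vector_derivative_comp_frechet[OF \<theta>(1) _ ub(1)] J(1) that])
        (use \<gamma> that in auto)
    then have v: "v s = frechet_derivative \<theta> (at (\<gamma> s)) (u s)" if "s \<in> J" for s
      using that by (simp add: v_def vector_derivative_at)
    let ?a = "frechet_derivative (\<lambda>y. frechet_derivative \<theta> (at y) (u t)) (at (\<gamma> t)) (u t)
        + frechet_derivative \<theta> (at (\<gamma> t)) (b t)"
    have va: "(v has_vector_derivative ?a) (at t)"
      by (rule has_vector_derivative_transform_within_open[OF
            has_vector_derivative_comp_frechet2[OF \<theta> _ ub(1,2)] J])
        (use \<gamma> J v in auto)
    then have a: "a t = ?a" by (simp add: a_def vector_derivative_at)
    have ct: "c t = \<theta> (\<gamma> t)" "\<gamma> t \<in> V" "\<gamma> t \<in> L" using \<gamma> J(2) by auto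
    have "\<forall>w\<in>tangent_space S (c t). g (c t) (a t) w + christoffel_first g (c t) (v t) (v t) w = 0"
      unfolding a v[OF J(2)] ct(1)
      by (rule iffD1[OF geodesic_equation_slice_chart[OF chart g S(2) ct(2,3)]])
        (use ub(3)[OF J(2)] in blast)
    then show ?thesis
      using c1[OF J(2)] va a v[OF J(2)] by simp
  qed
  then show "open I \<and> is_interval I \<and> c ` I \<subseteq> S \<and>
    (\<exists>v a. \<forall>t\<in>I. (c has_vector_derivative v t) (at t) \<and> (v has_vector_derivative a t) (at t) \<and>
       (\<forall>w\<in>tangent_space S (c t). g (c t) (a t) w + christoffel_first g (c t) (v t) (v t) w = 0))"
    using geo unfolding geodesic_on_def by blast
next
  assume "open I \<and> is_interval I \<and> c ` I \<subseteq> S \<and>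
    (\<exists>v a. \<forall>t\<in>I. (c has_vector_derivative v t) (at t) \<and> (v has_vector_derivative a t) (at t) \<and>
       (\<forall>w\<in>tangent_space S (c t). g (c t) (a t) w + christoffel_first g (c t) (v t) (v t) w = 0))"
  then obtain v a where I: "open I" "is_interval I" "c ` I \<subseteq> S"
    and va: "\<forall>t\<in>I. (c has_vector_derivative v t) (at t) \<and> (v has_vector_derivative a t) (at t) \<and>
       (\<forall>w\<in>tangent_space S (c t). g (c t) (a t) w + christoffel_first g (c t) (v t) (v t) w = 0)"
    by blast
  have "\<exists>J L V \<theta> \<gamma>.
        open J \<and> t\<^sub>0 \<in> J \<and> J \<subseteq> I \<and> slice_chart S L V \<theta> \<and>
        \<gamma> ` J \<subseteq> V \<inter> L \<and> (\<forall>t\<in>J. c t = \<theta> (\<gamma> t)) \<and>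
        geodesic_equation L (pullback_metric \<theta> g) \<gamma> J" if t0: "t\<^sub>0 \<in> I" for t\<^sub>0
  proof -
    obtain L V \<theta> where chart: "slice_chart S L V \<theta>" and "c t\<^sub>0 \<in> \<theta> ` V"
      using S(1) I(3) t0 unfolding embedded_submanifold_def by blast
    then obtain \<psi> where V: "open V" "open (\<theta> ` V)" and \<theta>: "smooth_on V \<theta>"
      and \<psi>: "smooth_on (\<theta> ` V) \<psi>" "\<And>y. y \<in> V \<Longrightarrow> \<psi> (\<theta> y) = y"
      and SV: "\<theta> ` (V \<inter> L) = S \<inter> \<theta> ` V"
      unfolding slice_chart_def by blast
    \<comment> \<open>All parameters at which the curve is inside the chart; \<open>\<psi>\<close>
      then provides its coordinates.\<close>
    define J where "J = I \<inter> c -` (\<theta> ` V)"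
    define \<gamma> where "\<gamma> = (\<lambda>t. \<psi> (c t))"
    have "continuous_on I c"
      using va by (meson continuous_at_imp_continuous_on has_vector_derivative_continuous)
    then have J: "open J" unfolding J_def by (rule continuous_open_preimage) (use I V in auto)
    have \<gamma>V: "\<gamma> t \<in> V \<inter> L \<and> c t = \<theta> (\<gamma> t)" if "t \<in> J" for t
    proof -
      have "c t \<in> \<theta> ` (V \<inter> L)" using that I SV by (auto simp: J_def)
      then show ?thesis using \<psi>(2) by (auto simp: \<gamma>_def)
    qed
    define u where "u = (\<lambda>t. frechet_derivative \<psi> (at (c t)) (v t))"
    define b where "b = (\<lambda>t. frechet_derivative (\<lambda>y. frechet_derivative \<psi> (at y) (v t)) (at (c t)) (v t)
      + frechet_derivative \<psi> (at (c t)) (a t))"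
    have ub: "(\<gamma> has_vector_derivative u t) (at t)" "(u has_vector_derivative b t) (at t)" if "t \<in> J" for t
      unfolding \<gamma>_def u_def b_def
      by (rule has_vector_derivative_comp_frechet[OF \<psi>(1)] has_vector_derivative_comp_frechet2[OF \<psi>(1) V(2)];
          use that va in \<open>auto simp: J_def\<close>)+
    have v: "v t = frechet_derivative \<theta> (at (\<gamma> t)) (u t)" if "t \<in> J" for t
    proof -
      have "(c has_vector_derivative frechet_derivative \<theta> (at (\<gamma> t)) (u t)) (at t)"
        by (rule has_vector_derivative_transform_within_open[OF
              has_vector_derivative_comp_frechet[OF \<theta> _ ub(1)] J])
          (use that \<gamma>V in auto)
      moreover have "t \<in> I" using that by (simp add: J_def)
      ultimately show ?thesis using va vector_derivative_unique_at by blast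
    qed
    have a: "a t = frechet_derivative (\<lambda>y. frechet_derivative \<theta> (at y) (u t)) (at (\<gamma> t)) (u t)
        + frechet_derivative \<theta> (at (\<gamma> t)) (b t)" (is "_ = ?a") if "t \<in> J" for t
    proof -
      have "(v has_vector_derivative ?a) (at t)"
        by (rule has_vector_derivative_transform_within_open[OF
              has_vector_derivative_comp_frechet2[OF \<theta> V(1) _ ub] J])
          (use that \<gamma>V v in auto)
      moreover have "t \<in> I" using that by (simp add: J_def)
      ultimately show ?thesis using va vector_derivative_unique_at by blast
    qed
    have "\<forall>w\<in>L. pullback_metric \<theta> g (\<gamma> t) (b t) w
          + christoffel_first (pullback_metric \<theta> g) (\<gamma> t) (u t) (u t) w = 0" if "t \<in> J" for t
      using geodesic_equation_slice_chart[OF chart g S(2), of "\<gamma> t" "b t" "u t"] \<gamma>V[OF that] va that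
      unfolding a[OF that, symmetric] v[OF that, symmetric] by (auto simp: J_def)
    with ub have "geodesic_equation L (pullback_metric \<theta> g) \<gamma> J"
      unfolding geodesic_equation_def by blast
    moreover have "t\<^sub>0 \<in> J" using t0 \<open>c t\<^sub>0 \<in> \<theta> ` V\<close> by (simp add: J_def)
    moreover have "\<gamma> ` J \<subseteq> V \<inter> L" "\<forall>t\<in>J. c t = \<theta> (\<gamma> t)" using \<gamma>V by auto
    ultimately show ?thesis using J chart J_def by blast
  qed
  then show "geodesic_on S g c I" using I unfolding geodesic_on_def by blast
qed

text \<open>Puts geodesics of the ambient space under the same criterion as those of a
  submanifold.\<close>

lemma embedded_submanifold_open:
  assumes "open M" shows "embedded_submanifold M"
proof -
  have "slice_chart M UNIV M (\<lambda>x. x)"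
    using assms smooth_on_id[OF assms] by (auto simp: slice_chart_def intro!: exI[of _ "\<lambda>x. x"])
  then show ?thesis unfolding embedded_submanifold_def by blast
qed

lemma riemannian_metric_on_euclidean: "riemannian_metric_on UNIV euclidean_riemannian_metric"
  unfolding riemannian_metric_on_def euclidean_riemannian_metric_def
  by (auto simp: bilinear_def inner_commute smooth_on_const bounded_linear.linear
      bounded_linear_inner_right bounded_linear_inner_left)

lemma christoffel_first_euclidean: "christoffel_first euclidean_riemannian_metric x u v w = 0"
  by (simp add: christoffel_first_def euclidean_riemannian_metric_def
      frechet_derivative_eqI[OF has_derivative_const])

section \<open>The ellipsoid\<close>

text \<open>Coordinate-free form of the hypothesis on \<open>B\<close>; the diagonal case is an
  instance by \<open>symmetric_positive_definite_diag\<close>.\<close>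

locale symmetric_positive_definite =
  fixes B :: "real ^ 'n ^ 'n"
  assumes symmetric: "(B *v x) \<bullet> y = x \<bullet> (B *v y)"
    and positive: "x \<noteq> 0 \<Longrightarrow> 0 < (B *v x) \<bullet> x"
begin

lemma bounded_linear_B: "bounded_linear ((*v) B)"
  by (rule matrix_vector_mul_bounded_linear)

lemmas B_simps = matrix_vector_right_distrib matrix_vector_mult_diff_distrib
  matrix_vector_mult_scaleR inner_add_left inner_add_right inner_diff_left inner_diff_right

lemma B_nonneg: "0 \<le> (B *v x) \<bullet> x"
  using positive[of x] by (cases "x = 0") auto

lemma B_nonzero: "x \<noteq> 0 \<Longrightarrow> B *v x \<noteq> 0"
  using positive[of x] by auto

lemma ellipsoid_nonzero: "x \<in> ellipsoid B \<Longrightarrow> x \<noteq> 0"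
  by (auto simp: ellipsoid_def)

lemma has_derivative_ds1_metric:
  assumes "x \<noteq> 0"
  shows "((\<lambda>y. ds1_metric B y u v) has_derivative
    (\<lambda>z. - 2 * ((B *v x) \<bullet> (B *v z)) * ((B *v u) \<bullet> v) / (norm (B *v x)) ^ 4)) (at x)"
proof -
  have N: "(B *v x) \<bullet> (B *v x) \<noteq> 0" using B_nonzero[OF assms] by simp
  have 4: "(norm (B *v x)) ^ 4 = ((B *v x) \<bullet> (B *v x)) * ((B *v x) \<bullet> (B *v x))"
    by (simp add: power2_norm_eq_inner[symmetric] power2_eq_square power4_eq_xxxx mult.assoc)
  show ?thesis
    unfolding ds1_metric_def power2_norm_eq_inner 4 using N
    by (auto intro!: derivative_eq_intros bounded_linear_imp_has_derivative[OF bounded_linear_B]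
        simp: field_simps inner_commute)
qed

lemma riemannian_metric_on_ds1: "riemannian_metric_on (- {0}) (ds1_metric B)"
proof -
  have "bilinear (ds1_metric B x)" for x
    unfolding bilinear_def ds1_metric_def
    by (auto intro!: linearI simp: B_simps add_divide_distrib)
  moreover have "ds1_metric B x u v = ds1_metric B x v u" for x u v
    unfolding ds1_metric_def by (metis symmetric inner_commute)
  moreover have "0 < ds1_metric B x u u" if "x \<noteq> 0" "u \<noteq> 0" for x u
    using positive[OF that(2)] B_nonzero[OF that(1)] by (simp add: ds1_metric_def)
  moreover have "smooth_on (- {0}) (\<lambda>x. ds1_metric B x u v)" for u v
    unfolding ds1_metric_def power2_norm_eq_inner
    by (intro smooth_on_divide smooth_on_const smooth_on_inner smooth_on_id
        smooth_on_bounded_linear[OF _ bounded_linear_B])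
      (use B_nonzero in auto)
  ultimately show ?thesis
    unfolding riemannian_metric_on_def by auto
qed

text \<open>The metric is the constant form (Bu, v) times a function, so the Christoffel symbols
  come only from the derivative of 1 / |Bx|^2: twice along \<open>v\<close>, once along
  \<open>w\<close> with the opposite sign.\<close>

lemma ds1_geodesic_expression:
  assumes "x \<noteq> 0"
  shows "ds1_metric B x a w + christoffel_first (ds1_metric B) x v v w
    = ((B *v a) \<bullet> w) / (norm (B *v x))\<^sup>2
      - 2 * ((B *v x) \<bullet> (B *v v)) * ((B *v v) \<bullet> w) / (norm (B *v x)) ^ 4
      + ((B *v x) \<bullet> (B *v w)) * ((B *v v) \<bullet> v) / (norm (B *v x)) ^ 4"
  unfolding christoffel_first_def frechet_derivative_eqI[OF has_derivative_ds1_metric[OF assms]]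
  by (simp add: ds1_metric_def field_simps)

text \<open>Stereographic projection from \<open>- p\<close>; the coordinate transversal to the ellipsoid
  rescales \<open>x + p\<close>, which keeps chart and inverse rational.\<close>

lemma slice_chart_ellipsoid:
  assumes p: "p \<in> ellipsoid B"
  shows "\<exists>V \<theta>. slice_chart (ellipsoid B) {y. (B *v p) \<bullet> y = 0} V \<theta> \<and> p \<in> \<theta> ` V"
proof -
  define q where "q = B *v p"
  have pq: "p \<bullet> q = 1" using p by (simp add: ellipsoid_def q_def inner_commute)
  define f where "f = (\<lambda>x. (B *v x) \<bullet> x)"
  have f0: "4 + f l > 0" for l using B_nonneg[of l] by (simp add: f_def)
  \<comment> \<open>Projection along \<open>p\<close> onto the hyperplane \<open>L\<close>; the
    remaining coordinate is \<open>y \<bullet> q\<close>.\<close>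
  define l where "l = (\<lambda>y. y - (y \<bullet> q) *\<^sub>R p)"
  \<comment> \<open>The ray from -p in the direction 2p + l, with l in \<open>L\<close>, meets the
    ellipsoid again at the factor 4 / (4 + f l). The extra 1 + y . q makes the point leave the
    ellipsoid exactly when y leaves \<open>L\<close>.\<close>
  define \<sigma> where "\<sigma> = (\<lambda>y. 4 * (1 + y \<bullet> q) / (4 + f (l y)))"
  define \<theta> where "\<theta> = (\<lambda>y. \<sigma> y *\<^sub>R (2 *\<^sub>R p + l y) - p)"
  \<comment> \<open>Recovers \<open>l y\<close> from x = \<open>\<theta> y\<close>: since (x + p) .
    q = 2 \<open>\<sigma> y\<close>, dividing x + p by \<open>\<sigma> y\<close> gives 2p +
    \<open>l y\<close>.\<close>
  define m where "m = (\<lambda>x. (2 / ((x + p) \<bullet> q)) *\<^sub>R (x + p) - 2 *\<^sub>R p)"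
  \<comment> \<open>The coefficient of \<open>p\<close> is y . q, obtained by solving the definition
    of \<open>\<sigma>\<close> for it.\<close>
  define \<psi> where "\<psi> = (\<lambda>x. m x + (((x + p) \<bullet> q) * (4 + f (m x)) / 8 - 1) *\<^sub>R p)"
  \<comment> \<open>The half-space on which \<open>\<sigma>\<close> is positive; its image is the
    half-space \<open>W\<close>, beyond the tangent hyperplane at -p.\<close>
  define V where "V = {y. - 1 < y \<bullet> q}"
  define W where "W = {x. 0 < (x + p) \<bullet> q}"
  have V: "open V" unfolding V_def by (intro open_Collect_less continuous_intros)
  have W: "open W" unfolding W_def by (intro open_Collect_less continuous_intros)
  have lq: "l y \<bullet> q = 0" for y by (simp add: l_def inner_diff_left pq)
  have mq: "m x \<bullet> q = 0" if "x \<in> W" for x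
    using that unfolding m_def inner_diff_left inner_scaleR_left pq by (simp add: W_def)
  have \<sigma>0: "\<sigma> y > 0" if "y \<in> V" for y using that f0 by (simp add: \<sigma>_def V_def)
  have \<theta>q: "(\<theta> y + p) \<bullet> q = 2 * \<sigma> y" for y
    by (simp add: \<theta>_def inner_add_left lq pq)
  have \<psi>\<theta>: "\<psi> (\<theta> y) = y" if "y \<in> V" for y
  proof -
    have "m (\<theta> y) = l y" using \<sigma>0[OF that] unfolding m_def \<theta>q by (simp add: \<theta>_def)
    then have "\<psi> (\<theta> y) = l y + (2 * \<sigma> y * (4 + f (l y)) / 8 - 1) *\<^sub>R p"
      unfolding \<psi>_def \<theta>q by simp
    moreover have "2 * \<sigma> y * (4 + f (l y)) / 8 - 1 = y \<bullet> q"
      using f0[of "l y"] by (simp add: \<sigma>_def field_simps)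
    ultimately show ?thesis by (simp add: l_def)
  qed
  have \<theta>\<psi>: "\<psi> x \<in> V \<and> \<theta> (\<psi> x) = x" if "x \<in> W" for x
  proof -
    let ?t = "((x + p) \<bullet> q) * (4 + f (m x)) / 8 - 1"
    have t: "\<psi> x \<bullet> q = ?t" using mq[OF that] by (simp add: \<psi>_def inner_add_left pq)
    have lm: "l (\<psi> x) = m x" unfolding l_def t by (simp add: \<psi>_def)
    have w: "0 < (x + p) \<bullet> q" using that by (simp add: W_def)
    have "0 < ((x + p) \<bullet> q) * (4 + f (m x))" using w f0 by simp
    then have "\<psi> x \<in> V" unfolding V_def mem_Collect_eq t by linarith
    moreover have "\<sigma> (\<psi> x) = ((x + p) \<bullet> q) / 2"
      unfolding \<sigma>_def lm t using f0[of "m x"] by (simp add: field_simps)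
    then have "\<theta> (\<psi> x) = x" unfolding \<theta>_def lm using w by (simp add: m_def)
    ultimately show ?thesis ..
  qed
  have image: "\<theta> ` V = W"
    using \<theta>\<psi> \<sigma>0 \<theta>q by (force simp: W_def)
  have on_ellipsoid: "\<theta> y \<in> ellipsoid B \<longleftrightarrow> y \<bullet> q = 0" if "y \<in> V" for y
  proof -
    have pl: "(B *v p) \<bullet> l y = 0" "(B *v l y) \<bullet> p = 0"
      using lq[of y] unfolding symmetric[of "l y" p] by (simp_all add: q_def inner_commute)
    have "f (\<theta> y) = (\<sigma> y)\<^sup>2 * (4 + f (l y)) - 4 * \<sigma> y + 1"
      using pq pl unfolding f_def \<theta>_def
      by (simp add: B_simps q_def inner_commute algebra_simps power2_eq_square)
    then have "f (\<theta> y) - 1 = \<sigma> y * (\<sigma> y * (4 + f (l y)) - 4)"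
      by (simp add: algebra_simps power2_eq_square)
    then have "\<theta> y \<in> ellipsoid B \<longleftrightarrow> \<sigma> y * (\<sigma> y * (4 + f (l y)) - 4) = 0"
      by (metis (mono_tags) ellipsoid_def f_def eq_iff_diff_eq_0 mem_Collect_eq)
    also have "\<dots> \<longleftrightarrow> \<sigma> y * (4 + f (l y)) = 4" using \<sigma>0[OF that] by simp
    also have "\<dots> \<longleftrightarrow> y \<bullet> q = 0" using f0[of "l y"] by (simp add: \<sigma>_def)
    finally show ?thesis .
  qed
  have smooth_f: "smooth_on U (\<lambda>x. f (h x))" if "open U" "smooth_on U h" for U h
    unfolding f_def
    by (intro smooth_on_inner smooth_on_bounded_linear[OF _ bounded_linear_B] that)
  have smooth_l: "smooth_on V l"
    unfolding l_def
    by (intro smooth_on_diff smooth_on_scaleR smooth_on_inner smooth_on_id smooth_on_const V)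
  have smooth_\<theta>: "smooth_on V \<theta>"
    unfolding \<theta>_def \<sigma>_def using f0
    by (intro smooth_on_diff smooth_on_scaleR smooth_on_divide smooth_on_mult smooth_on_add
        smooth_on_inner smooth_on_id smooth_on_const smooth_f smooth_l V) (simp add: less_imp_neq[symmetric])
  have smooth_m: "smooth_on W m"
    unfolding m_def
    by (intro smooth_on_diff smooth_on_scaleR smooth_on_divide smooth_on_add
        smooth_on_inner smooth_on_id smooth_on_const W) (simp add: W_def)
  have smooth_\<psi>: "smooth_on W \<psi>"
    unfolding \<psi>_def
    by (intro smooth_on_diff smooth_on_scaleR smooth_on_divide smooth_on_mult smooth_on_add
        smooth_on_inner smooth_on_id smooth_on_const smooth_f smooth_m W) simp
  have "slice_chart (ellipsoid B) {y. q \<bullet> y = 0} V \<theta>"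
    unfolding slice_chart_def image
    using V W smooth_\<theta> smooth_\<psi> \<psi>\<theta> on_ellipsoid image subspace_hyperplane[of q]
    by (auto simp: inner_commute[of q])
  moreover have "p \<in> \<theta> ` V" unfolding image by (simp add: W_def inner_add_left pq)
  ultimately show ?thesis unfolding q_def by blast
qed

lemma embedded_submanifold_ellipsoid: "embedded_submanifold (ellipsoid B)"
  unfolding embedded_submanifold_def
proof (intro exI[of _ "DIM(real ^ 'n) - 1"] ballI)
  fix p assume p: "p \<in> ellipsoid B"
  show "\<exists>L V \<theta>. slice_chart (ellipsoid B) L V \<theta> \<and> dim L = DIM(real ^ 'n) - 1 \<and> p \<in> \<theta> ` V"
    using slice_chart_ellipsoid[OF p] dim_hyperplane[OF B_nonzero[OF ellipsoid_nonzero[OF p]]] by blast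
qed

lemma ellipsoid_velocity:
  assumes \<eta>: "(\<eta> has_vector_derivative w) (at t)"
    "\<forall>\<^sub>F s in at t. \<eta> s \<in> ellipsoid B" "\<eta> t \<in> ellipsoid B"
  shows "(B *v \<eta> t) \<bullet> w = 0"
proof -
  have "((\<lambda>s. (B *v \<eta> s) \<bullet> \<eta> s) has_vector_derivative
      (B *v \<eta> t) \<bullet> w + (B *v w) \<bullet> \<eta> t) (at t)"
    by (intro bounded_bilinear.has_vector_derivative[OF bounded_bilinear_inner]
        bounded_linear.has_vector_derivative[OF bounded_linear_B] \<eta>)
  moreover have "((\<lambda>s. (B *v \<eta> s) \<bullet> \<eta> s) has_vector_derivative 0) (at t)"
    unfolding has_vector_derivative_def
    by (rule has_derivative_transform_eventually[where f = "\<lambda>_. 1"])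
      (use \<eta> in \<open>auto simp: ellipsoid_def elim: eventually_mono\<close>)
  ultimately have "(B *v \<eta> t) \<bullet> w + (B *v w) \<bullet> \<eta> t = 0"
    using vector_derivative_unique_at by blast
  then show ?thesis
    unfolding symmetric[of w "\<eta> t"] by (simp add: inner_commute)
qed

lemma tangent_space_ellipsoid:
  assumes x: "x \<in> ellipsoid B"
  shows "tangent_space (ellipsoid B) x = {w. (B *v x) \<bullet> w = 0}"
proof (intro equalityI subsetI)
  fix w assume "w \<in> tangent_space (ellipsoid B) x"
  then show "w \<in> {w. (B *v x) \<bullet> w = 0}"
    using ellipsoid_velocity x unfolding tangent_space_def by blast
next
  fix w assume "w \<in> {w. (B *v x) \<bullet> w = 0}"
  then have xw: "(B *v x) \<bullet> w = 0" "(B *v w) \<bullet> x = 0" 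
    unfolding symmetric[of w x] by (simp_all add: inner_commute)
  \<comment> \<open>The tangent line x + s w scaled radially back to the ellipsoid. The cross terms
    vanish, so (B(x + s w), x + s w) = 1 + s^2 (Bw, w), and the scaling factor has derivative 0 at s
    = 0.\<close>
  define \<eta> where "\<eta> = (\<lambda>s. (1 / sqrt (1 + s\<^sup>2 * ((B *v w) \<bullet> w))) *\<^sub>R (x + s *\<^sub>R w))"
  have pos: "1 + s\<^sup>2 * ((B *v w) \<bullet> w) > 0" for s using B_nonneg[of w] by (simp add: add_pos_nonneg)
  have "((\<lambda>s. 1 / sqrt (1 + s\<^sup>2 * ((B *v w) \<bullet> w))) has_real_derivative 0) (at 0)"
    by (auto intro!: derivative_eq_intros)
  moreover have "((\<lambda>s. x + s *\<^sub>R w) has_vector_derivative w) (at 0)"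
    by (auto intro!: derivative_eq_intros)
  ultimately have "(\<eta> has_vector_derivative
     (1 / sqrt (1 + 0\<^sup>2 * ((B *v w) \<bullet> w))) *\<^sub>R w + 0 *\<^sub>R (x + 0 *\<^sub>R w)) (at 0)"
    unfolding \<eta>_def by (rule has_vector_derivative_scaleR)
  moreover have "\<eta> s \<in> ellipsoid B" for s
  proof -
    let ?r = "sqrt (1 + s\<^sup>2 * ((B *v w) \<bullet> w))"
    have "(B *v (x + s *\<^sub>R w)) \<bullet> (x + s *\<^sub>R w) = ?r * ?r"
      using xw x pos[of s] by (simp add: B_simps ellipsoid_def power2_eq_square)
    then show ?thesis
      using pos[of s] unfolding \<eta>_def ellipsoid_def mem_Collect_eq matrix_vector_mult_scaleR inner_scaleR
      by (simp add: field_simps)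
  qed
  moreover have "\<eta> 0 = x" by (simp add: \<eta>_def)
  ultimately show "w \<in> tangent_space (ellipsoid B) x" unfolding tangent_space_def by auto
qed

end

lemma diag_matrix_mult: "diag_matrix b *v x = (\<chi> i. b i * x $ i)"
  by (simp add: diag_matrix_def matrix_vector_mult_def vec_eq_iff if_distrib[of "\<lambda>t. t * _"] cong: if_cong)

lemma symmetric_positive_definite_diag:
  assumes "\<And>k. b k > 0"
  shows "symmetric_positive_definite (diag_matrix b)"
proof
  note mult = diag_matrix_mult
  show "(diag_matrix b *v x) \<bullet> y = x \<bullet> (diag_matrix b *v y)" for x y
    by (simp add: mult inner_vec_def ac_simps)
  show "0 < (diag_matrix b *v x) \<bullet> x" if x: "x \<noteq> 0" for x
  proof -
    obtain i where "x $ i \<noteq> 0" using x by (auto simp: vec_eq_iff)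
    then have "0 < (\<Sum>i\<in>UNIV. b i * (x $ i * x $ i))"
      using assms by (intro sum_pos2[of _ i]) (auto simp: less_imp_le zero_less_mult_iff not_square_less_zero
          simp flip: power2_eq_square)
    then show ?thesis by (simp add: mult inner_vec_def ac_simps)
  qed
qed

section \<open>The ellipsoid is totally geodesic\<close>

context symmetric_positive_definite
begin

text \<open>The first identity is obtained at every parameter of \<open>I\<close>, since it has to
  be differentiated once more at \<open>t\<close>.\<close>

lemma ellipsoid_curve_velocity_acceleration:
  assumes I: "open I" "c ` I \<subseteq> ellipsoid B" and t: "t \<in> I"
    and c: "\<And>t. t \<in> I \<Longrightarrow> (c has_vector_derivative v t) (at t)"
    and v: "(v has_vector_derivative a) (at t)"
  shows "(B *v c t) \<bullet> v t = 0" "(B *v c t) \<bullet> a = - ((B *v v t) \<bullet> v t)"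
proof -
  have 0: "(B *v c s) \<bullet> v s = 0" if s: "s \<in> I" for s
    by (rule ellipsoid_velocity[OF c[OF s]])
      (use I(2) s eventually_at_in_open'[OF I(1) s] in \<open>auto elim!: eventually_mono\<close>)
  show "(B *v c t) \<bullet> v t = 0" using 0[OF t] .
  have "((\<lambda>s. (B *v c s) \<bullet> v s) has_vector_derivative (B *v c t) \<bullet> a + (B *v v t) \<bullet> v t) (at t)"
    by (intro bounded_bilinear.has_vector_derivative[OF bounded_bilinear_inner]
        bounded_linear.has_vector_derivative[OF bounded_linear_B] c v t)
  moreover have "((\<lambda>s. (B *v c s) \<bullet> v s) has_vector_derivative 0) (at t)"
    by (rule has_vector_derivative_transform_within_open[OF has_vector_derivative_const I(1) t])
      (simp add: 0)
  ultimately have "(B *v c t) \<bullet> a + (B *v v t) \<bullet> v t = 0" using vector_derivative_unique_at by blast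
  then show "(B *v c t) \<bullet> a = - ((B *v v t) \<bullet> v t)" by linarith
qed

lemma norm_B_pow4: "(norm (B *v x)) ^ 4 = ((norm (B *v x))\<^sup>2)\<^sup>2"
  by simp

text \<open>The \<open>ds1\<close>-orthogonal complement of the tangent space at \<open>x\<close> is spanned by \<open>x\<close>, and the
  geodesic equation in this direction is the second derivative of \<open>(Bx, x) = 1\<close>.\<close>

lemma totally_geodesic_ellipsoid:
  "totally_geodesic_submanifold (- {0}) (ds1_metric B) (ellipsoid B)"
proof -
  note g = riemannian_metric_on_ds1
  have sub: "ellipsoid B \<subseteq> - {0}" using ellipsoid_nonzero by blast
  have op: "open (- {0 :: real ^ 'n})" by (simp add: open_Compl)
  have "geodesic_on (- {0}) (ds1_metric B) c I" if geo: "geodesic_on (ellipsoid B) (ds1_metric B) c I" for c I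
  proof -
    obtain v a where I: "open I" "is_interval I" "c ` I \<subseteq> ellipsoid B"
      and va: "\<And>t. t \<in> I \<Longrightarrow> (c has_vector_derivative v t) (at t)"
      "\<And>t. t \<in> I \<Longrightarrow> (v has_vector_derivative a t) (at t)"
      "\<And>t w. t \<in> I \<Longrightarrow> w \<in> tangent_space (ellipsoid B) (c t) \<Longrightarrow>
          ds1_metric B (c t) (a t) w + christoffel_first (ds1_metric B) (c t) (v t) (v t) w = 0"
      using geo unfolding geodesic_on_iff_tangent_space[OF g embedded_submanifold_ellipsoid sub] by blast
    have "ds1_metric B (c t) (a t) w + christoffel_first (ds1_metric B) (c t) (v t) (v t) w = 0"
      if t: "t \<in> I" for t w
    proof -
      have E: "c t \<in> ellipsoid B" using I t by blast
      then have nz: "c t \<noteq> 0" by (rule ellipsoid_nonzero)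
      define \<rho> where "\<rho> = (norm (B *v c t))\<^sup>2"
      have \<rho>: "\<rho> > 0" "(B *v c t) \<bullet> (B *v c t) = \<rho>" using B_nonzero[OF nz] by (simp_all add: \<rho>_def power2_norm_eq_inner)
      \<comment> \<open>Because (Bx, x) = 1 on the ellipsoid, this is the coefficient that makes w -
        k x tangent.\<close>
      define k where "k = (B *v c t) \<bullet> w"
      define u where "u = w - k *\<^sub>R c t"
      have w: "w = u + k *\<^sub>R c t" by (simp add: u_def)
      have "(B *v c t) \<bullet> u = 0"
        using E by (simp add: u_def k_def inner_diff_right ellipsoid_def)
      then have u: "ds1_metric B (c t) (a t) u + christoffel_first (ds1_metric B) (c t) (v t) (v t) u = 0"
        by (intro va(3) t) (simp add: tangent_space_ellipsoid[OF E])
      note vel = ellipsoid_curve_velocity_acceleration[OF I(1,3) t va(1) va(2)[OF t]]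
      have "(B *v a t) \<bullet> c t = - ((B *v v t) \<bullet> v t)" "(B *v v t) \<bullet> c t = 0"
        using vel unfolding symmetric[of _ "c t"] by (simp_all add: inner_commute)
      \<comment> \<open>The middle term of the expression contains (Bv, x) = 0; the other two add up
        to ((Ba, x) + (Bv, v)) / \<open>\<rho>\<close>, which is zero.\<close>
      then have "ds1_metric B (c t) (a t) (c t) + christoffel_first (ds1_metric B) (c t) (v t) (v t) (c t) = 0"
        unfolding ds1_geodesic_expression[OF nz] norm_B_pow4 \<rho>_def[symmetric] \<rho>(2)
        using \<rho>(1) by (simp add: power2_eq_square)
      moreover have "ds1_metric B (c t) (a t) w + christoffel_first (ds1_metric B) (c t) (v t) (v t) w
          = (ds1_metric B (c t) (a t) u + christoffel_first (ds1_metric B) (c t) (v t) (v t) u)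
          + k * (ds1_metric B (c t) (a t) (c t) + christoffel_first (ds1_metric B) (c t) (v t) (v t) (c t))"
        unfolding ds1_geodesic_expression[OF nz] w
        by (simp add: B_simps add_divide_distrib diff_divide_distrib algebra_simps)
      ultimately show ?thesis using u by simp
    qed
    with I sub va(1,2) show ?thesis
      unfolding geodesic_on_iff_tangent_space[OF g embedded_submanifold_open[OF op] order_refl] by blast
  qed
  then show ?thesis
    unfolding totally_geodesic_submanifold_def using g embedded_submanifold_ellipsoid sub by blast
qed

lemma euclidean_geodesic_acceleration:
  assumes E: "x \<in> ellipsoid B" and T: "\<And>w. (B *v x) \<bullet> w = 0 \<Longrightarrow> a \<bullet> w = 0"
    and a: "(B *v x) \<bullet> a = - k"
  shows "a = - (k / (norm (B *v x))\<^sup>2) *\<^sub>R (B *v x)"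
proof -
  have nz: "(norm (B *v x))\<^sup>2 \<noteq> 0" using B_nonzero[OF ellipsoid_nonzero[OF E]] by simp
  \<comment> \<open>The coefficient makes \<open>?w\<close> tangent. As \<open>a\<close> and Bx are
    both orthogonal to tangent vectors, \<open>?w\<close> is orthogonal to itself.\<close>
  let ?w = "a + (k / (norm (B *v x))\<^sup>2) *\<^sub>R (B *v x)"
  have "(B *v x) \<bullet> ?w = 0" using nz a by (simp add: inner_add_right power2_norm_eq_inner)
  then have "a \<bullet> ?w = 0" "(B *v x) \<bullet> ?w = 0" using T by blast+
  then have "?w \<bullet> ?w = 0" by (simp only: inner_add_left inner_scaleR_left)
  then have "?w = 0" by simp
  then show ?thesis by (simp add: eq_neg_iff_add_eq_0)
qed

end

section \<open>Reparametrisation by the Knoerrer parameter\<close>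

text \<open>Strict monotonicity gives injectivity, and a continuous injection on an open subset of
  the line is open. The inverse is then differentiable from the pointwise derivative of
  \<open>\<tau>\<close>, without continuity of \<open>\<alpha>\<close>.\<close>

lemma increasing_reparametrisation:
  fixes \<tau> :: "real \<Rightarrow> real"
  assumes I: "open I" "is_interval I"
    and \<tau>: "\<And>s. s \<in> I \<Longrightarrow> (\<tau> has_real_derivative \<alpha> s) (at s)" "\<And>s. s \<in> I \<Longrightarrow> 0 < \<alpha> s"
  shows "inj_on \<tau> I" "open (\<tau> ` I)" "is_interval (\<tau> ` I)"
    "\<And>s. s \<in> I \<Longrightarrow> (inv_into I \<tau> has_real_derivative inverse (\<alpha> s)) (at (\<tau> s))"
proof -
  have less: "\<tau> s < \<tau> t" if "s \<in> I" "t \<in> I" "s < t" for s t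
  proof (rule DERIV_pos_imp_increasing[OF that(3)])
    fix r assume "s \<le> r" "r \<le> t"
    then have "r \<in> I" using mem_is_interval_1_I[OF I(2) that(1,2)] by blast
    then show "\<exists>y. (\<tau> has_real_derivative y) (at r) \<and> 0 < y" using \<tau> by blast
  qed
  show inj: "inj_on \<tau> I" by (rule linorder_inj_onI') (use less in fastforce)
  have cont: "continuous_on I \<tau>"
    using \<tau>(1) by (meson continuous_at_imp_continuous_on DERIV_isCont)
  show "open (\<tau> ` I)"
    using injective_into_1d_imp_open_map_UNIV[OF I(1) cont inj] by simp
  show "is_interval (\<tau> ` I)"
    using connected_continuous_image[OF cont] I(2) by (simp add: is_interval_connected_1)
  show "(inv_into I \<tau> has_real_derivative inverse (\<alpha> s)) (at (\<tau> s))" if "s \<in> I" for s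
    unfolding has_field_derivative_def
    by (rule has_derivative_inverse_strong[OF I(1) that cont _ \<tau>(1)[OF that, unfolded has_field_derivative_def]])
      (use inj \<tau>(2)[OF that] in \<open>auto simp: fun_eq_iff inv_into_f_f\<close>)
qed

context symmetric_positive_definite
begin

lemma knoerrer_reparametrisation_geodesic:
  assumes geo: "geodesic_on (ellipsoid B) euclidean_riemannian_metric x I"
    and kn: "knoerrer_parameter B x I \<tau>"
  shows "inj_on \<tau> I"
    and "geodesic_on (ellipsoid B) (ds1_metric B) (x \<circ> inv_into I \<tau>) (\<tau> ` I)"
    and "natural_parameter_on (ds1_metric B) (x \<circ> inv_into I \<tau>) (\<tau> ` I)"
proof -
  obtain v a where I: "open I" "is_interval I" "x ` I \<subseteq> ellipsoid B"
    and va: "\<And>t. t \<in> I \<Longrightarrow> (x has_vector_derivative v t) (at t)"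
      "\<And>t. t \<in> I \<Longrightarrow> (v has_vector_derivative a t) (at t)"
      "\<And>t w. t \<in> I \<Longrightarrow> w \<in> tangent_space (ellipsoid B) (x t) \<Longrightarrow> a t \<bullet> w = 0"
    using geo unfolding geodesic_on_iff_tangent_space[OF riemannian_metric_on_euclidean
        embedded_submanifold_ellipsoid subset_UNIV] christoffel_first_euclidean
      euclidean_riemannian_metric_def add_0_right by blast
  define \<rho> where "\<rho> = (\<lambda>s. (norm (B *v x s))\<^sup>2)"
  define \<mu> where "\<mu> = (\<lambda>s. (B *v x s) \<bullet> (B *v v s))"
  have E: "x s \<in> ellipsoid B" and \<rho>: "\<rho> s > 0" if "s \<in> I" for s
    using I(3) that B_nonzero[OF ellipsoid_nonzero] by (auto simp: \<rho>_def)
  obtain \<alpha> where \<alpha>: "\<And>s. s \<in> I \<Longrightarrow> 0 < \<alpha> s"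
    "\<And>s. s \<in> I \<Longrightarrow> (\<alpha> s)\<^sup>2 = ((B *v v s) \<bullet> v s) / \<rho> s"
    "\<And>s. s \<in> I \<Longrightarrow> (\<tau> has_real_derivative \<alpha> s) (at s)"
    using kn vector_derivative_at[OF va(1)] unfolding knoerrer_parameter_def \<rho>_def by metis
  have speed: "(B *v v s) \<bullet> v s = (\<alpha> s)\<^sup>2 * \<rho> s" if "s \<in> I" for s
    using \<alpha>(2)[OF that] \<rho>[OF that] by (simp add: field_simps)
  have acc: "a s = - (\<alpha> s)\<^sup>2 *\<^sub>R (B *v x s)" if "s \<in> I" for s
  proof -
    have "a s = - (((B *v v s) \<bullet> v s) / (norm (B *v x s))\<^sup>2) *\<^sub>R (B *v x s)"
      using va(3)[OF that] ellipsoid_curve_velocity_acceleration(2)[OF I(1,3) that va(1) va(2)[OF that]]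
      by (intro euclidean_geodesic_acceleration E that) (auto simp: tangent_space_ellipsoid[OF E[OF that]])
    then show ?thesis using \<alpha>(2)[OF that] by (simp add: \<rho>_def)
  qed
  \<comment> \<open>With k = (Bv, v) one has k' = 2 (Bv, a) = -2 \<open>\<alpha>\<close>^2
    \<open>\<mu>\<close> by the acceleration formula, and \<open>\<rho>\<close>' = 2
    \<open>\<mu>\<close>; hence the derivative of \<open>\<alpha>\<close>^2 = k /
    \<open>\<rho>\<close> is -4 \<open>\<alpha>\<close>^2 \<open>\<mu>\<close> /
    \<open>\<rho>\<close>.\<close>
  have D\<alpha>: "(\<alpha> has_real_derivative - 2 * \<mu> s / \<rho> s * \<alpha> s) (at s)" if s: "s \<in> I" for s
  proof -
    have Bx: "((\<lambda>s. B *v x s) has_vector_derivative B *v v s) (at s)"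
      and Bv: "((\<lambda>s. B *v v s) has_vector_derivative B *v a s) (at s)"
      by (intro bounded_linear.has_vector_derivative[OF bounded_linear_B] va s)+
    have d\<rho>: "(\<rho> has_real_derivative 2 * \<mu> s) (at s)"
      using bounded_bilinear.has_vector_derivative[OF bounded_bilinear_inner Bx Bx]
      unfolding \<rho>_def \<mu>_def power2_norm_eq_inner has_real_derivative_iff_has_vector_derivative
      by (simp add: inner_commute)
    have "(B *v v s) \<bullet> a s + (B *v a s) \<bullet> v s = - 2 * (\<alpha> s)\<^sup>2 * \<mu> s"
      unfolding symmetric[of "a s" "v s"] by (simp add: acc[OF s] \<mu>_def inner_commute)
    then have dk: "((\<lambda>s. (B *v v s) \<bullet> v s) has_real_derivative - 2 * (\<alpha> s)\<^sup>2 * \<mu> s) (at s)"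
      using bounded_bilinear.has_vector_derivative[OF bounded_bilinear_inner Bv va(2)[OF s]]
      unfolding has_real_derivative_iff_has_vector_derivative by simp
    have "((\<lambda>s. ((B *v v s) \<bullet> v s) / \<rho> s) has_real_derivative
        (- 2 * (\<alpha> s)\<^sup>2 * \<mu> s * \<rho> s - ((B *v v s) \<bullet> v s) * (2 * \<mu> s)) / (\<rho> s * \<rho> s)) (at s)"
      using \<rho>[OF s] by (intro DERIV_divide dk d\<rho>) simp
    also have "(- 2 * (\<alpha> s)\<^sup>2 * \<mu> s * \<rho> s - ((B *v v s) \<bullet> v s) * (2 * \<mu> s)) / (\<rho> s * \<rho> s)
        = - 4 * (\<alpha> s)\<^sup>2 * \<mu> s / \<rho> s"
      unfolding speed[OF s] using \<rho>[OF s] by (simp add: field_simps)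
    finally have dq: "((\<lambda>s. ((B *v v s) \<bullet> v s) / \<rho> s) has_real_derivative - 4 * (\<alpha> s)\<^sup>2 * \<mu> s / \<rho> s) (at s)" .
    \<comment> \<open>Differentiability of \<open>\<alpha>\<close> comes from here: positivity
      selects the root, and the square root is differentiable at positive values.\<close>
    have sq: "\<alpha> r = sqrt (((B *v v r) \<bullet> v r) / \<rho> r)" if "r \<in> I" for r
      using \<alpha>(1,2)[OF that] by (metis less_imp_le real_sqrt_abs abs_of_nonneg)
    have "0 < ((B *v v s) \<bullet> v s) / \<rho> s" using \<alpha>(1,2)[OF s] by (metis zero_less_power)
    from DERIV_chain2[OF DERIV_real_sqrt[OF this] dq]
    have "((\<lambda>s. sqrt (((B *v v s) \<bullet> v s) / \<rho> s)) has_real_derivative - 2 * \<mu> s / \<rho> s * \<alpha> s) (at s)"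
      unfolding sq[OF s, symmetric] using \<alpha>(1)[OF s] by (simp add: field_simps power2_eq_square)
    then show ?thesis
      by (rule has_field_derivative_transform_within_open[OF _ I(1) s]) (simp add: sq)
  qed
  note rep = increasing_reparametrisation[OF I(1,2) \<alpha>(3,1)]
  show "inj_on \<tau> I" by (rule rep(1))
  define \<sigma> where "\<sigma> = inv_into I \<tau>"
  define u where "u = (\<lambda>r. inverse (\<alpha> (\<sigma> r)) *\<^sub>R v (\<sigma> r))"
  \<comment> \<open>Acceleration with respect to \<open>\<tau>\<close>, that is a /
    \<open>\<alpha>\<close>^2 - \<open>\<alpha>\<close>' v / \<open>\<alpha>\<close>^3, after
    inserting the formulas for \<open>a\<close> and \<open>\<alpha>\<close>'.\<close>
  define b where "b = (\<lambda>r. - (B *v x (\<sigma> r)) + (2 * \<mu> (\<sigma> r) / (\<rho> (\<sigma> r) * (\<alpha> (\<sigma> r))\<^sup>2)) *\<^sub>R v (\<sigma> r))"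
  have \<sigma>: "\<sigma> (\<tau> s) = s" "(\<sigma> has_vector_derivative inverse (\<alpha> s)) (at (\<tau> s))" if "s \<in> I" for s
    using rep(1,4) that
    by (simp_all add: \<sigma>_def inv_into_f_f has_real_derivative_iff_has_vector_derivative[symmetric])
  have u: "((x \<circ> \<sigma>) has_vector_derivative u (\<tau> s)) (at (\<tau> s))" if s: "s \<in> I" for s
    using vector_diff_chain_at[OF \<sigma>(2)[OF s], of x "v s"] va(1)[OF s] \<sigma>(1)[OF s] by (simp add: u_def)
  have b: "(u has_vector_derivative b (\<tau> s)) (at (\<tau> s))" if s: "s \<in> I" for s
  proof -
    have "((\<lambda>s. inverse (\<alpha> s)) has_real_derivative
        - (inverse (\<alpha> s) * (- 2 * \<mu> s / \<rho> s * \<alpha> s) * inverse (\<alpha> s))) (at s)"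
      using \<alpha>(1)[OF s] by (intro DERIV_inverse' D\<alpha> s) simp
    from has_vector_derivative_scaleR[OF this va(2)[OF s]]
    have "((\<lambda>s. inverse (\<alpha> s) *\<^sub>R v s) has_vector_derivative \<alpha> s *\<^sub>R b (\<tau> s)) (at s)"
      using \<alpha>(1)[OF s]
      by (simp add: b_def \<sigma>(1)[OF s] acc[OF s] algebra_simps power2_eq_square divide_inverse)
    then show ?thesis
      using vector_diff_chain_at[OF \<sigma>(2)[OF s], of "\<lambda>s. inverse (\<alpha> s) *\<^sub>R v s" "\<alpha> s *\<^sub>R b (\<tau> s)"]
        \<alpha>(1)[OF s] \<sigma>(1)[OF s] by (simp add: u_def o_def)
  qed
  \<comment> \<open>Dividing by \<open>\<rho>\<close> gives speed 1 in the new metric; the same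
    identity evaluates the last term of the geodesic expression.\<close>
  have unit: "(B *v u (\<tau> s)) \<bullet> u (\<tau> s) = \<rho> s" if s: "s \<in> I" for s
    using \<alpha>(1)[OF s] speed[OF s]
    by (simp add: u_def \<sigma>(1)[OF s] B_simps field_simps power2_eq_square)
  have eq: "ds1_metric B (x s) (b (\<tau> s)) w + christoffel_first (ds1_metric B) (x s) (u (\<tau> s)) (u (\<tau> s)) w = 0"
    if s: "s \<in> I" for s w
  proof -
    have 1: "(B *v b (\<tau> s)) \<bullet> w
        = - ((B *v x s) \<bullet> (B *v w)) + 2 * \<mu> s / (\<rho> s * (\<alpha> s)\<^sup>2) * ((B *v v s) \<bullet> w)"
      by (simp add: b_def \<sigma>(1)[OF s] B_simps symmetric[of "B *v x s"]
          linear_neg[OF bounded_linear.linear[OF bounded_linear_B]])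
    have 2: "(B *v x s) \<bullet> (B *v u (\<tau> s)) = \<mu> s / \<alpha> s"
      "(B *v u (\<tau> s)) \<bullet> w = ((B *v v s) \<bullet> w) / \<alpha> s"
      by (simp_all add: u_def \<sigma>(1)[OF s] B_simps \<mu>_def divide_inverse)
    have N: "(norm (B *v x s))\<^sup>2 = \<rho> s" by (simp add: \<rho>_def)
    show ?thesis
      unfolding ds1_geodesic_expression[OF ellipsoid_nonzero[OF E[OF s]]] norm_B_pow4 1 2 unit[OF s] N
      using \<alpha>(1)[OF s] \<rho>[OF s] by (simp add: field_simps power2_eq_square)
  qed
  have sub: "ellipsoid B \<subseteq> - {0}" using ellipsoid_nonzero by blast
  have "\<forall>r\<in>\<tau> ` I. ((x \<circ> \<sigma>) has_vector_derivative u r) (at r) \<and> (u has_vector_derivative b r) (at r) \<and>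
      (\<forall>w\<in>tangent_space (ellipsoid B) ((x \<circ> \<sigma>) r). ds1_metric B ((x \<circ> \<sigma>) r) (b r) w
        + christoffel_first (ds1_metric B) ((x \<circ> \<sigma>) r) (u r) (u r) w = 0)"
    using u b eq by (auto simp: \<sigma>(1))
  moreover have "(x \<circ> \<sigma>) ` \<tau> ` I \<subseteq> ellipsoid B" using E by (auto simp: \<sigma>(1))
  ultimately show "geodesic_on (ellipsoid B) (ds1_metric B) (x \<circ> inv_into I \<tau>) (\<tau> ` I)"
    using rep(2,3)
    unfolding geodesic_on_iff_tangent_space[OF riemannian_metric_on_ds1 embedded_submanifold_ellipsoid sub]
      \<sigma>_def[symmetric] by blast
  show "natural_parameter_on (ds1_metric B) (x \<circ> inv_into I \<tau>) (\<tau> ` I)"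
    unfolding natural_parameter_on_def \<sigma>_def[symmetric]
  proof (clarify)
    fix s assume s: "s \<in> I"
    show "ds1_metric B ((x \<circ> \<sigma>) (\<tau> s)) (vector_derivative (x \<circ> \<sigma>) (at (\<tau> s)))
        (vector_derivative (x \<circ> \<sigma>) (at (\<tau> s))) = 1"
      using \<rho>[OF s] unfolding vector_derivative_at[OF u[OF s]] ds1_metric_def unit[OF s]
      by (simp add: \<sigma>(1)[OF s] \<rho>_def)
  qed
qed

end


theorem theorem9p2:
  fixes b :: "'n::finite \<Rightarrow> real" and B :: "real ^ 'n ^ 'n"
  assumes b_pos: "\<And>k. b k > 0"
    and B_diag: "B = diag_matrix b"
  shows "totally_geodesic_submanifold (- {0}) (ds1_metric B) (ellipsoid B) \<and>
    (\<forall>x\<in>- {0}. \<forall>u. ds1_metric B x u u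
        = (\<Sum>k\<in>UNIV. b k * (u $ k)\<^sup>2) / (\<Sum>k\<in>UNIV. (b k)\<^sup>2 * (x $ k)\<^sup>2)) \<and>
    (\<forall>x I \<tau>.
        geodesic_on (ellipsoid B) euclidean_riemannian_metric x I \<and>
        natural_parameter_on euclidean_riemannian_metric x I \<and>
        knoerrer_parameter B x I \<tau> \<longrightarrow>
          inj_on \<tau> I \<and>
          geodesic_on (ellipsoid B) (ds1_metric B) (x \<circ> inv_into I \<tau>) (\<tau> ` I) \<and>
          geodesic_on (- {0}) (ds1_metric B) (x \<circ> inv_into I \<tau>) (\<tau> ` I) \<and>
          natural_parameter_on (ds1_metric B) (x \<circ> inv_into I \<tau>) (\<tau> ` I))"
proof -
  interpret symmetric_positive_definite B
    unfolding B_diag using b_pos by (rule symmetric_positive_definite_diag)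
  have mult: "B *v x = (\<chi> i. b i * x $ i)" for x
    unfolding B_diag by (rule diag_matrix_mult)
  have "ds1_metric B x u u = (\<Sum>k\<in>UNIV. b k * (u $ k)\<^sup>2) / (\<Sum>k\<in>UNIV. (b k)\<^sup>2 * (x $ k)\<^sup>2)" for x u
    unfolding ds1_metric_def power2_norm_eq_inner mult
    by (simp add: inner_vec_def power2_eq_square ac_simps)
  \<comment> \<open>The claim about geodesics of the punctured space is total geodesy applied to the
    reparametrised curve.\<close>
  then show ?thesis
    using totally_geodesic_ellipsoid knoerrer_reparametrisation_geodesic
    unfolding totally_geodesic_submanifold_def by blast
qed

end
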